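(* There exists a universal constant $c>0$ such that for every $\alpha>0$ there exist $\beta,\gamma>0$ (depending only on $\alpha$) for which the following holds. For every $n\ge1$ and every monotone function $f:\{-1,1\}^n\to\{0,1\}$ with $\mathbb{E}[f]\le\frac12$: if $\mathbb{S}_{\rho}(f)\ge\alpha\,\mathbb{E}[f]^2$ for $\rho=c/\log(1/\mathbb{E}[f])$, then $$W^1(f)\ge\beta\,\mathbb{E}[f]^2\log(1/\mathbb{E}[f]),$$ and consequently there exists a halfspace $g:\{-1,1\}^n\to\{0,1\}$ such that $\mathrm{Cov}(f,g)\ge\gamma\,\mathbb{E}[f]$.
   Context: Expectations are with respect to the uniform measure on $\{-1,1\}^n$. Monotone means nondecreasing in each coordinate. For $\rho\in[0,1]$, $\mathbb{S}_\rho(f)=\mathrm{Cov}(f(x),f(y))$, where $x$ is uniform in $\{-1,1\}^n$ and $y$ is obtained from $x$ by independently keeping each coordinate unchanged with probability $\rho$ and replacing it by a uniformly random value in $\{-1,1\}$ with probability $1-\rho$. $W^1(f)=\sum_i\hat f(\{i\})^2$ with $\hat f(\{i\})=\mathbb{E}[f(x)x_i]$. $\mathrm{Cov}(f,g)=\mathbb{E}[fg]-\mathbb{E}[f]\mathbb{E}[g]$. A halfspace is a function of the form $g(x)=\mathbf{1}\left(\sum_i a_ix_i>t\right)$ with $a\in\mathbb{R}^n$, $t\in\mathbb{R}$. $\log$ is the natural logarithm. If $\mathbb{E}[f]=0$, $\rho$ and $\mathbb{E}[f]^2\log(1/\mathbb{E}[f])$ are interpreted as $0$. The constant $c$ is small,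 in particular $c\le\log 2$, so that $\rho\in[0,1]$. *)

theory Defs
  imports "HOL-Probability.Probability"
begin

(* Points of {-1,1}^n are extensional functions on {..<n}, i.e. they take the value
   undefined outside {..<n}; so cube n has exactly 2^n elements. *)
definition cube :: "nat \<Rightarrow> (nat \<Rightarrow> real) set" where
  "cube n = {..<n} \<rightarrow>\<^sub>E {-1, 1}"

definition expect :: "nat \<Rightarrow> ((nat \<Rightarrow> real) \<Rightarrow> real) \<Rightarrow> real" where
  "expect n f = measure_pmf.expectation (pmf_of_set (cube n)) f"

definition pmf_cov :: "'a pmf \<Rightarrow> ('a \<Rightarrow> real) \<Rightarrow> ('a \<Rightarrow> real) \<Rightarrow> real" where
  "pmf_cov p X Y = measure_pmf.expectation p (\<lambda>\<omega>. X \<omega> * Y \<omega>)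
     - measure_pmf.expectation p X * measure_pmf.expectation p Y"

definition cov :: "nat \<Rightarrow> ((nat \<Rightarrow> real) \<Rightarrow> real) \<Rightarrow> ((nat \<Rightarrow> real) \<Rightarrow> real) \<Rightarrow> real" where
  "cov n f g = pmf_cov (pmf_of_set (cube n)) f g"

definition cube_monotone :: "nat \<Rightarrow> ((nat \<Rightarrow> real) \<Rightarrow> real) \<Rightarrow> bool" where
  "cube_monotone n f \<longleftrightarrow> (\<forall>i<n. \<forall>x\<in>cube n. mono_on {-1, 1} (\<lambda>b. f (x(i := b))))"

definition resample :: "real \<Rightarrow> real \<Rightarrow> real pmf" where
  "resample \<rho> b = bind_pmf (bernoulli_pmf \<rho>)
     (\<lambda>keep. if keep then return_pmf b else pmf_of_set {-1, 1})"

(* The default value undefined of the product measure matches the extensionality of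
   cube n.  bernoulli_pmf clamps its argument, so noise is meaningful for \<rho> in [0,1] only. *)
definition noise :: "nat \<Rightarrow> real \<Rightarrow> (nat \<Rightarrow> real) \<Rightarrow> (nat \<Rightarrow> real) pmf" where
  "noise n \<rho> x = Pi_pmf {..<n} undefined (\<lambda>i. resample \<rho> (x i))"

definition correlated_pair :: "nat \<Rightarrow> real \<Rightarrow> ((nat \<Rightarrow> real) \<times> (nat \<Rightarrow> real)) pmf" where
  "correlated_pair n \<rho> =
     bind_pmf (pmf_of_set (cube n)) (\<lambda>x. map_pmf (\<lambda>y. (x, y)) (noise n \<rho> x))"

definition noise_stability :: "nat \<Rightarrow> real \<Rightarrow> ((nat \<Rightarrow> real) \<Rightarrow> real) \<Rightarrow> real" where
  "noise_stability n \<rho> f = pmf_cov (correlated_pair n \<rho>) (\<lambda>(x, y). f x) (\<lambda>(x, y). f y)"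

definition fourier1 :: "nat \<Rightarrow> ((nat \<Rightarrow> real) \<Rightarrow> real) \<Rightarrow> nat \<Rightarrow> real" where
  "fourier1 n f i = expect n (\<lambda>x. f x * x i)"

definition W1 :: "nat \<Rightarrow> ((nat \<Rightarrow> real) \<Rightarrow> real) \<Rightarrow> real" where
  "W1 n f = (\<Sum>i<n. (fourier1 n f i)\<^sup>2)"

definition halfspace :: "nat \<Rightarrow> ((nat \<Rightarrow> real) \<Rightarrow> real) \<Rightarrow> bool" where
  "halfspace n g \<longleftrightarrow> (\<exists>(a :: nat \<Rightarrow> real) (t :: real).
     \<forall>x\<in>cube n. g x = of_bool ((\<Sum>i<n. a i * x i) > t))"

(* The expressions c / ln (1 / expect n f) and (expect n f)^2 * ln (1 / expect n f) need no
   special treatment when expect n f = 0: as 1 / 0 = 0 and ln 0 = 0, both are 0, which is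
   the intended convention. *)
lemma "c / ln (1 / (0::real)) = 0" and "0\<^sup>2 * ln (1 / (0::real)) = 0"
  by simp_all

end

theory Submission
  imports Defs
begin

text \<open>
Write \<open>\<mu>\<close> for the mean of \<open>f\<close>, \<open>L = ln (1 / \<mu>)\<close>, and \<open>\<Phi>(s)\<close> for the sum of
\<open>|S| s^(|S| - 1) fhat(S)^2\<close> over all sets \<open>S\<close>. This is the derivative of the noise stability
\<open>\<Sum> s^|S| fhat(S)^2\<close> in \<open>s\<close>, and \<open>\<Phi>(0) = W1\<close>. The heart of the proof is the inequality
\<open>\<Phi>(s)^3 \<le> W1 * \<Phi>(3 s)^2\<close> (lemma \<open>total_derivative_energy_growth\<close>), which lets the first
level control the growth of noise stability at small rates. To see it, smooth the \<open>i\<close>-th discrete derivative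
of \<open>f\<close> by noise of rate \<open>sqrt s\<close>. For monotone \<open>f\<close> the result is nonnegative, so its \<open>L^1\<close> norm is its
mean, which is the Fourier coefficient of \<open>{i}\<close>; its squared \<open>L^2\<close> norm is the share of \<open>i\<close> in
\<open>\<Phi>(s)\<close>; and by hypercontractivity its squared \<open>L^4\<close> norm is at most the share of \<open>i\<close> in \<open>\<Phi>(3 s)\<close>.
Interpolating \<open>L^2\<close> between \<open>L^1\<close> and \<open>L^4\<close> for each \<open>i\<close>, and then Hoelder's inequality over \<open>i\<close>,
give the claim.

Take \<open>\<rho> = 1 / (15 L)\<close>. The hypothesis on the noise stability gives \<open>\<rho> \<Phi>(\<rho>) \<ge> \<alpha> \<mu>^2\<close>. For an upper
bound on \<open>\<Phi>(3 \<rho>)\<close>, hypercontractivity for moments of order about \<open>L\<close> shows that the noise stability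
of an indicator function of mean \<open>\<mu>\<close>, with the squared mean included, is still \<open>O(\<mu>^2)\<close> at rate
\<open>6 \<rho>\<close> (lemma \<open>noise_energy_small_set\<close>), whence \<open>\<Phi>(3 \<rho>) = O(\<mu>^2 L)\<close>. Together these bounds force
\<open>W1 \<ge> \<beta> \<mu>^2 L\<close> with \<open>\<beta>\<close> of order \<open>\<alpha>^3\<close>.

For the halfspace, let \<open>v\<close> be the normalised linear part of \<open>f\<close>, so that
\<open>E[f v] = sqrt W1 \<ge> sqrt (\<beta> L) \<mu>\<close>. The same moment method gives \<open>E[f v^2] = O(L \<mu>)\<close>, so truncating
\<open>v\<close> at a height \<open>T\<close> of order \<open>sqrt (L / \<beta>)\<close> keeps half of this correlation. The covariance of \<open>f\<close>
with the truncation is the integral over \<open>t \<in> [-T, T]\<close> of its covariances with the halfspaces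
\<open>v > t\<close>, so one of these covariances is at least the average, which is of order \<open>\<beta> \<mu>\<close>.
\<close>

section \<open>Averages over the discrete cube\<close>

lemma finite_cube: "finite (cube n)"
  unfolding cube_def by (intro finite_PiE) auto

lemma card_cube: "card (cube n) = 2 ^ n"
  unfolding cube_def by (simp add: card_PiE numeral_2_eq_2)

lemma cube_nonempty: "cube n \<noteq> {}"
  using card_cube[of n] by force

lemma cube_coord: "x \<in> cube n \<Longrightarrow> i < n \<Longrightarrow> x i = -1 \<or> x i = 1"
  unfolding cube_def by (auto dest: PiE_mem)

lemma cube_coord_square: "x \<in> cube n \<Longrightarrow> i < n \<Longrightarrow> x i * x i = 1"
  using cube_coord[of x n i] by auto

lemma cube_update: "x \<in> cube n \<Longrightarrow> i < n \<Longrightarrow> b \<in> {-1, 1} \<Longrightarrow> x(i := b) \<in> cube n"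
  unfolding cube_def by (auto simp: PiE_iff extensional_def)

lemma expectation_uniform_cube:
  "measure_pmf.expectation (pmf_of_set (cube n)) h = expect n h"
  by (simp add: expect_def)

lemma expect_eq: "expect n h = (\<Sum>x\<in>cube n. h x) / 2 ^ n"
  unfolding expect_def
  by (subst integral_pmf_of_set) (use cube_nonempty finite_cube card_cube in auto)

lemma expect_cong: "(\<And>x. x \<in> cube n \<Longrightarrow> g x = h x) \<Longrightarrow> expect n g = expect n h"
  by (simp add: expect_eq)

lemma expect_mono: "(\<And>x. x \<in> cube n \<Longrightarrow> g x \<le> h x) \<Longrightarrow> expect n g \<le> expect n h"
  unfolding expect_eq by (intro divide_right_mono sum_mono) auto

lemma expect_const [simp]: "expect n (\<lambda>x. c) = c"
  by (simp add: expect_eq card_cube)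

lemma expect_add: "expect n (\<lambda>x. g x + h x) = expect n g + expect n h"
  by (simp add: expect_eq sum.distrib add_divide_distrib)

lemma expect_diff: "expect n (\<lambda>x. g x - h x) = expect n g - expect n h"
  by (simp add: expect_eq sum_subtractf diff_divide_distrib)

lemma expect_cmult: "expect n (\<lambda>x. c * h x) = c * expect n h"
  by (simp add: expect_eq sum_distrib_left)

lemma expect_multc: "expect n (\<lambda>x. h x * c) = expect n h * c"
  by (simp add: expect_eq sum_distrib_right)

lemma expect_divide: "expect n (\<lambda>x. h x / c) = expect n h / c"
  by (simp add: expect_eq sum_divide_distrib mult.commute)

lemma expect_sum: "expect n (\<lambda>x. \<Sum>i\<in>I. h i x) = (\<Sum>i\<in>I. expect n (h i))"
  by (simp add: expect_eq sum.swap[of _ _ I] sum_divide_distrib)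

lemma expect_nonneg: "(\<And>x. x \<in> cube n \<Longrightarrow> 0 \<le> h x) \<Longrightarrow> 0 \<le> expect n h"
  using expect_mono[of n "\<lambda>_. 0" h] by simp

lemma expect_flip:
  assumes "i < n"
  shows "expect n (\<lambda>x. h (x(i := - x i))) = expect n h"
proof -
  have mem: "x(i := - x i) \<in> cube n" if "x \<in> cube n" for x
    using cube_update[OF that assms, of "- x i"] cube_coord[OF that assms] by auto
  have "(\<Sum>x\<in>cube n. h (x(i := - x i))) = (\<Sum>x\<in>cube n. h x)"
    by (rule sum.reindex_bij_witness[of _ "\<lambda>x. x(i := - x i)" "\<lambda>x. x(i := - x i)"])
      (use mem in auto)
  then show ?thesis
    by (simp add: expect_eq)
qed

lemma expect_coordinate_times:
  assumes "i < n" and indep: "\<And>x b. h (x(i := b)) = h x"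
  shows "expect n (\<lambda>x. x i * h x) = 0"
proof -
  have "expect n (\<lambda>x. x i * h x) = expect n (\<lambda>x. (x(i := - x i)) i * h (x(i := - x i)))"
    using expect_flip[OF assms(1), of "\<lambda>x. x i * h x"] by simp
  also have "\<dots> = - expect n (\<lambda>x. x i * h x)"
    using expect_cmult[of n "-1" "\<lambda>x. x i * h x"] by (simp add: indep)
  finally show ?thesis by simp
qed

lemma expect_Cauchy_Schwarz:
  "(expect n (\<lambda>x. g x * h x))\<^sup>2 \<le> expect n (\<lambda>x. (g x)\<^sup>2) * expect n (\<lambda>x. (h x)\<^sup>2)"
proof -
  have "(expect n (\<lambda>x. g x * h x))\<^sup>2 = (\<Sum>x\<in>cube n. g x * h x)\<^sup>2 / (2 ^ n)\<^sup>2"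
    by (simp add: expect_eq power_divide)
  also have "\<dots> \<le> ((\<Sum>x\<in>cube n. (g x)\<^sup>2) * (\<Sum>x\<in>cube n. (h x)\<^sup>2)) / (2 ^ n)\<^sup>2"
    by (intro divide_right_mono Cauchy_Schwarz_ineq_sum) auto
  also have "\<dots> = expect n (\<lambda>x. (g x)\<^sup>2) * expect n (\<lambda>x. (h x)\<^sup>2)"
    by (simp add: expect_eq power2_eq_square)
  finally show ?thesis .
qed

text \<open>The \<open>L^2\<close> norm interpolates between the \<open>L^1\<close> and \<open>L^4\<close> norms; two applications of Cauchy-Schwarz,
\<open>E[u^2]^2 \<le> E[u] E[u^3]\<close> and \<open>E[u^3]^2 \<le> E[u^2] E[u^4]\<close>, suffice for these exponents.\<close>

lemma second_moment_interpolation: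
  assumes "\<And>x. x \<in> cube n \<Longrightarrow> 0 \<le> u x"
  shows "(expect n (\<lambda>x. (u x)\<^sup>2)) ^ 3 \<le> (expect n u)\<^sup>2 * expect n (\<lambda>x. (u x) ^ 4)"
proof -
  define A1 A2 A3 A4 where "A1 = expect n u" and "A2 = expect n (\<lambda>x. (u x)\<^sup>2)"
    and "A3 = expect n (\<lambda>x. (u x) ^ 3)" and "A4 = expect n (\<lambda>x. (u x) ^ 4)"
  have nonneg: "0 \<le> A1" "0 \<le> A2" "0 \<le> A3" "0 \<le> A4"
    unfolding A1_def A2_def A3_def A4_def using assms by (auto intro!: expect_nonneg)
  have "(expect n (\<lambda>x. sqrt (u x) * (sqrt (u x) * u x)))\<^sup>2
        \<le> expect n (\<lambda>x. (sqrt (u x))\<^sup>2) * expect n (\<lambda>x. (sqrt (u x) * u x)\<^sup>2)"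
    by (rule expect_Cauchy_Schwarz)
  moreover have "expect n (\<lambda>x. sqrt (u x) * (sqrt (u x) * u x)) = A2"
    "expect n (\<lambda>x. (sqrt (u x))\<^sup>2) = A1" "expect n (\<lambda>x. (sqrt (u x) * u x)\<^sup>2) = A3"
    unfolding A1_def A2_def A3_def using assms
    by (auto intro!: expect_cong simp: power_mult_distrib power2_eq_square power3_eq_cube)
  ultimately have 1: "A2\<^sup>2 \<le> A1 * A3" by simp
  have "(expect n (\<lambda>x. u x * (u x)\<^sup>2))\<^sup>2 \<le> expect n (\<lambda>x. (u x)\<^sup>2) * expect n (\<lambda>x. ((u x)\<^sup>2)\<^sup>2)"
    by (rule expect_Cauchy_Schwarz)
  then have 2: "A3\<^sup>2 \<le> A2 * A4"
    unfolding A2_def A3_def A4_def by (simp add: power2_eq_square power3_eq_cube numeral_eq_Suc mult.assoc)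
  have "A2 ^ 3 * A2 = (A2\<^sup>2)\<^sup>2"
    by (simp add: power2_eq_square power3_eq_cube)
  also have "\<dots> \<le> (A1 * A3)\<^sup>2"
    using 1 by (intro power_mono) auto
  also have "\<dots> = A1\<^sup>2 * A3\<^sup>2"
    by (simp add: power_mult_distrib)
  also have "\<dots> \<le> A1\<^sup>2 * (A2 * A4)"
    using 2 by (intro mult_left_mono) auto
  finally have "A2 ^ 3 * A2 \<le> (A1\<^sup>2 * A4) * A2"
    by (simp add: mult_ac)
  then have "A2 ^ 3 \<le> A1\<^sup>2 * A4"
    using nonneg by (cases "A2 = 0") auto
  then show ?thesis
    unfolding A1_def A2_def A4_def .
qed

lemma weighted_AM_GM_power:
  fixes x y :: real
  assumes "0 \<le> x" "0 \<le> y" "j \<le> m" "0 < m"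
  shows "x ^ (m - j) * y ^ j \<le> (real (m - j) * x ^ m + real j * y ^ m) / real m"
proof (cases "x = 0 \<or> y = 0")
  case True
  then show ?thesis
    using assms by (cases "j = m"; cases "j = 0"; auto simp: power_0_left divide_simps)
next
  case False
  then have pos: "0 < x" "0 < y" using assms by auto
  have powr_eq: "(z ^ m) powr (real k / real m) = z ^ k" if "0 < z" for z :: real and k
    using that \<open>0 < m\<close> by (simp add: powr_realpow[symmetric] powr_powr)
  have "(x ^ m) powr (real (m - j) / real m) * (y ^ m) powr (real j / real m)
        \<le> real (m - j) / real m * x ^ m + real j / real m * y ^ m"
    by (rule Youngs_inequality_0) (use assms pos in \<open>auto simp: field_simps of_nat_diff\<close>)
  then show ?thesis
    using pos by (simp add: powr_eq add_divide_distrib)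
qed

text \<open>Hoelder's inequality for integer exponents, in terms of upper bounds \<open>p\<close> and \<open>q\<close> on the norms:
after division by \<open>p\<close> and \<open>q\<close> it is the pointwise weighted AM-GM inequality. The degenerate
bounds \<open>p = 0\<close> and \<open>q = 0\<close> follow by approximating them from above.\<close>

lemma expect_Holder_power:
  assumes U: "\<And>x. x \<in> cube n \<Longrightarrow> 0 \<le> U x" and V: "\<And>x. x \<in> cube n \<Longrightarrow> 0 \<le> V x"
    and p: "0 \<le> p" "expect n (\<lambda>x. U x ^ m) \<le> p ^ m"
    and q: "0 \<le> q" "expect n (\<lambda>x. V x ^ m) \<le> q ^ m"
    and j: "j \<le> m" "0 < m"
  shows "expect n (\<lambda>x. U x ^ (m - j) * V x ^ j) \<le> p ^ (m - j) * q ^ j"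
proof -
  have pos_case: "expect n (\<lambda>x. U x ^ (m - j) * V x ^ j) \<le> P ^ (m - j) * Q ^ j"
    if P: "p \<le> P" "0 < P" and Q: "q \<le> Q" "0 < Q" for P Q
  proof -
    have "expect n (\<lambda>x. U x ^ (m - j) * V x ^ j)
        = expect n (\<lambda>x. P ^ (m - j) * Q ^ j * ((U x / P) ^ (m - j) * (V x / Q) ^ j))"
      using P Q by (intro expect_cong) (simp add: power_divide)
    also have "\<dots> \<le> expect n (\<lambda>x. P ^ (m - j) * Q ^ j *
        ((real (m - j) * (U x / P) ^ m + real j * (V x / Q) ^ m) / real m))"
      using P Q U V j by (intro expect_mono mult_left_mono weighted_AM_GM_power) auto
    also have "\<dots> = P ^ (m - j) * Q ^ j *
        ((real (m - j) * (expect n (\<lambda>x. U x ^ m) / P ^ m)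
          + real j * (expect n (\<lambda>x. V x ^ m) / Q ^ m)) / real m)"
      by (simp add: expect_cmult expect_divide expect_add power_divide)
    also have "\<dots> \<le> P ^ (m - j) * Q ^ j * ((real (m - j) * 1 + real j * 1) / real m)"
    proof -
      have "expect n (\<lambda>x. U x ^ m) / P ^ m \<le> 1"
        using p P power_mono[OF P(1) p(1), of m] by (simp add: divide_simps)
      moreover have "expect n (\<lambda>x. V x ^ m) / Q ^ m \<le> 1"
        using q Q power_mono[OF Q(1) q(1), of m] by (simp add: divide_simps)
      ultimately show ?thesis
        using P Q by (intro mult_left_mono divide_right_mono add_mono) auto
    qed
    also have "\<dots> = P ^ (m - j) * Q ^ j"
      using j by (simp add: of_nat_diff)
    finally show ?thesis .
  qed
  have lim: "((\<lambda>e. (p + e) ^ (m - j) * (q + e) ^ j) \<longlongrightarrow> (p + 0) ^ (m - j) * (q + 0) ^ j) (at_right 0)"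
    by (intro tendsto_intros)
  have "eventually (\<lambda>e. expect n (\<lambda>x. U x ^ (m - j) * V x ^ j) \<le> (p + e) ^ (m - j) * (q + e) ^ j)
      (at_right 0)"
    using eventually_at_right_less[of "0::real"]
    by eventually_elim (use p q in \<open>auto intro!: pos_case\<close>)
  from tendsto_lowerbound[OF lim this] show ?thesis by simp
qed

lemma indicator_cases: "f \<in> cube n \<rightarrow> {0, 1} \<Longrightarrow> x \<in> cube n \<Longrightarrow> f x = (0::real) \<or> f x = 1"
  by (auto dest: funcset_mem)

text \<open>Multiplication by an indicator function and division by its mean is averaging over its support,
so this is Jensen's inequality for that average, followed by dropping the indicator.\<close>

lemma indicator_power_mean:
  assumes f: "f \<in> cube n \<rightarrow> {0, 1}" and "even k" "0 < k"
  shows "(expect n (\<lambda>x. f x * h x)) ^ k \<le> expect n f ^ (k - 1) * expect n (\<lambda>x. h x ^ k)"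
proof (cases "expect n f = 0")
  case True
  then have "f x = 0" if "x \<in> cube n" for x
  proof -
    have "(\<Sum>x\<in>cube n. f x) = 0" using True by (simp add: expect_eq)
    moreover have "0 \<le> f x" if "x \<in> cube n" for x
      using indicator_cases[OF f that] by auto
    ultimately show ?thesis
      using that finite_cube by (subst (asm) sum_nonneg_eq_0_iff) auto
  qed
  then have "expect n (\<lambda>x. f x * h x) = expect n (\<lambda>x. 0)"
    by (intro expect_cong) auto
  moreover have "0 \<le> expect n f ^ (k - 1) * expect n (\<lambda>x. h x ^ k)"
    using True \<open>even k\<close> by (auto intro!: mult_nonneg_nonneg expect_nonneg simp: zero_le_even_power)
  ultimately show ?thesis
    using \<open>0 < k\<close> by (simp add: zero_power)
next
  case False
  have fpos: "0 \<le> f x" "f x \<le> 1" if "x \<in> cube n" for x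
    using indicator_cases[OF f that] by auto
  have mu: "0 < expect n f" using False expect_nonneg[of n f] fpos by force
  define w where "w x = f x / (2 ^ n * expect n f)" for x
  have w_sum: "(\<Sum>x\<in>cube n. w x * H x) = expect n (\<lambda>x. f x * H x) / expect n f" for H
    by (simp add: w_def expect_eq[of n "\<lambda>x. f x * H x"] sum_divide_distrib)
  have "(\<Sum>x\<in>cube n. w x *\<^sub>R h x) ^ k \<le> (\<Sum>x\<in>cube n. w x * h x ^ k)"
  proof (rule convex_on_sum[OF finite_cube cube_nonempty convex_power_even[OF \<open>even k\<close>]])
    show "(\<Sum>x\<in>cube n. w x) = 1"
      using w_sum[of "\<lambda>_. 1"] mu by simp
  qed (use mu fpos in \<open>auto simp: w_def\<close>)
  then have "expect n (\<lambda>x. f x * h x) ^ k / expect n f ^ k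
      \<le> expect n (\<lambda>x. f x * h x ^ k) / expect n f"
    by (simp add: w_sum power_divide)
  then have "expect n (\<lambda>x. f x * h x) ^ k
      \<le> expect n (\<lambda>x. f x * h x ^ k) / expect n f * expect n f ^ k"
    using mu by (simp add: divide_simps)
  also have "\<dots> = expect n f ^ (k - 1) * expect n (\<lambda>x. f x * h x ^ k)"
    using mu \<open>0 < k\<close> by (cases k) auto
  also have "\<dots> \<le> expect n f ^ (k - 1) * expect n (\<lambda>x. h x ^ k)"
    using mu fpos \<open>even k\<close>
    by (intro mult_left_mono expect_mono) (auto intro!: mult_left_le_one_le simp: zero_le_even_power)
  finally show ?thesis .
qed

section \<open>Fourier analysis on the cube\<close>

definition character :: "nat set \<Rightarrow> (nat \<Rightarrow> real) \<Rightarrow> real" where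
  "character S x = (\<Prod>i\<in>S. x i)"

definition fourier :: "nat \<Rightarrow> ((nat \<Rightarrow> real) \<Rightarrow> real) \<Rightarrow> nat set \<Rightarrow> real" where
  "fourier n f S = expect n (\<lambda>x. f x * character S x)"

lemma character_empty [simp]: "character {} x = 1"
  by (simp add: character_def)

lemma character_singleton [simp]: "character {i} x = x i"
  by (simp add: character_def)

lemma character_insert: "finite S \<Longrightarrow> i \<notin> S \<Longrightarrow> character (insert i S) x = x i * character S x"
  by (simp add: character_def)

lemma character_update: "i \<notin> S \<Longrightarrow> character S (x(i := b)) = character S x"
  unfolding character_def by (intro prod.cong) auto

lemma fourier_empty [simp]: "fourier n f {} = expect n f"
  by (simp add: fourier_def)

text \<open>If the sets differ, flipping a coordinate that belongs to exactly one of them changes the sign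
of the product.\<close>

lemma character_orthonormal:
  assumes "S \<subseteq> {..<n}" "T \<subseteq> {..<n}"
  shows "expect n (\<lambda>x. character S x * character T x) = of_bool (S = T)"
proof -
  have aux: "expect n (\<lambda>x. character S x * character T x) = 0"
    if sub: "S \<subseteq> {..<n}" "T \<subseteq> {..<n}" and i: "i \<in> S" "i \<notin> T" for S T i
  proof -
    have S: "S = insert i (S - {i})" "finite S"
      using i sub finite_subset by auto
    have "character S x = x i * character (S - {i}) x" for x
      using S by (metis character_insert finite_Diff Diff_iff insertI1)
    moreover have "expect n (\<lambda>x. x i * (character (S - {i}) x * character T x)) = 0"
      using i sub by (intro expect_coordinate_times) (auto simp: character_update)
    ultimately show ?thesis by (simp add: mult.assoc)
  qed
  show ?thesis
  proof (cases "S = T")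
    case True
    have "expect n (\<lambda>x. character S x * character S x) = expect n (\<lambda>x. 1)"
      using assms by (intro expect_cong)
        (auto simp: character_def prod.distrib[symmetric] cube_coord_square intro!: prod.neutral)
    then show ?thesis using True by simp
  next
    case False
    then obtain i where "i \<in> S \<and> i \<notin> T \<or> i \<in> T \<and> i \<notin> S" by blast
    then show ?thesis
      using aux[of S T i] aux[of T S i] assms False by (auto simp: mult.commute)
  qed
qed

lemma expect_character: "S \<subseteq> {..<n} \<Longrightarrow> expect n (character S) = of_bool (S = {})"
  using character_orthonormal[of S n "{}"] by simp

text \<open>All functions below are given by their coefficients, and noise acts on the coefficient of \<open>S\<close> as
multiplication by a power \<open>card S\<close> of the noise rate.\<close>

definition multilinear :: "nat set \<Rightarrow> (nat set \<Rightarrow> real) \<Rightarrow> (nat \<Rightarrow> real) \<Rightarrow> real" where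
  "multilinear A a x = (\<Sum>S\<in>Pow A. a S * character S x)"

lemma expect_multilinear:
  assumes "A \<subseteq> {..<n}"
  shows "expect n (multilinear A a) = a {}"
proof -
  have fin: "finite A" using assms finite_subset by auto
  have "expect n (multilinear A a) = (\<Sum>S\<in>Pow A. a S * expect n (character S))"
    by (simp add: multilinear_def[abs_def] expect_sum expect_cmult)
  also have "\<dots> = (\<Sum>S\<in>Pow A. if S = {} then a S else 0)"
    using assms by (intro sum.cong) (auto simp: expect_character)
  finally show ?thesis using fin by simp
qed

lemma Parseval_multilinear:
  assumes "A \<subseteq> {..<n}"
  shows "expect n (\<lambda>x. (multilinear A a x)\<^sup>2) = (\<Sum>S\<in>Pow A. (a S)\<^sup>2)"
proof -
  have fin: "finite A" using assms finite_subset by auto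
  have "expect n (\<lambda>x. (multilinear A a x)\<^sup>2)
      = (\<Sum>S\<in>Pow A. \<Sum>T\<in>Pow A. a S * a T * expect n (\<lambda>x. character S x * character T x))"
    by (simp add: multilinear_def power2_eq_square sum_product expect_sum expect_cmult[symmetric] mult_ac)
  also have "\<dots> = (\<Sum>S\<in>Pow A. \<Sum>T\<in>Pow A. if S = T then a S * a T else 0)"
    using assms by (intro sum.cong refl) (auto simp: character_orthonormal)
  finally show ?thesis using fin by (simp add: power2_eq_square)
qed

text \<open>Expanding the product over subsets identifies the damping of coefficients with averaging against
a product kernel. For \<open>0 \<le> r \<le> 1\<close> the kernel is nonnegative, which is invisible on the Fourier side.\<close>

lemma noise_kernel_expansion:
  assumes "finite A"
  shows "multilinear A (\<lambda>S. r ^ card S * expect n (\<lambda>z. g z * character S z)) x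
    = expect n (\<lambda>z. g z * (\<Prod>i\<in>A. 1 + r * x i * z i))"
proof -
  have "(\<Prod>i\<in>A. 1 + r * x i * z i) = (\<Sum>S\<in>Pow A. r ^ card S * character S x * character S z)" for z
  proof -
    have "(\<Prod>i\<in>A. 1 + r * x i * z i) = (\<Prod>i\<in>A. r * x i * z i + 1)"
      by (simp add: add.commute)
    also have "\<dots> = (\<Sum>S\<in>Pow A. \<Prod>i\<in>S. r * x i * z i)"
      by (subst prod_add[OF assms]) simp
    finally show ?thesis by (simp add: prod.distrib character_def)
  qed
  then show ?thesis
    by (simp add: multilinear_def sum_distrib_left expect_sum expect_cmult[symmetric] expect_multc[symmetric] mult_ac)
qed

text \<open>At rate 1 the kernel is the point mass at \<open>x\<close>, scaled by the size of the cube: one factor vanishes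
as soon as \<open>z\<close> differs from \<open>x\<close>.\<close>

lemma Fourier_inversion_kernel:
  assumes x: "x \<in> cube n"
  shows "expect n (\<lambda>z. f z * (\<Prod>i<n. 1 + x i * z i)) = f x"
proof -
  have kernel: "(\<Prod>i<n. 1 + x i * z i) = (if z = x then 2 ^ n else 0)" if z: "z \<in> cube n" for z
  proof (cases "z = x")
    case True
    then show ?thesis using x by (simp add: cube_coord_square)
  next
    case False
    then obtain i where i: "i < n" "z i \<noteq> x i"
      using x z unfolding cube_def by (metis PiE_ext lessThan_iff)
    then have "1 + x i * z i = 0"
      using cube_coord[OF x i(1)] cube_coord[OF z i(1)] by auto
    then show ?thesis using i False by (auto intro!: prod_zero)
  qed
  have "expect n (\<lambda>z. f z * (\<Prod>i<n. 1 + x i * z i)) = expect n (\<lambda>z. if z = x then f z * 2 ^ n else 0)"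
    by (intro expect_cong) (simp add: kernel)
  also have "\<dots> = f x"
    using x by (simp add: expect_eq finite_cube)
  finally show ?thesis .
qed

definition noise_operator :: "nat \<Rightarrow> real \<Rightarrow> ((nat \<Rightarrow> real) \<Rightarrow> real) \<Rightarrow> (nat \<Rightarrow> real) \<Rightarrow> real" where
  "noise_operator n r f = multilinear {..<n} (\<lambda>S. r ^ card S * fourier n f S)"

lemma expect_times_noise_operator:
  "expect n (\<lambda>x. f x * noise_operator n r f x) = (\<Sum>S\<in>Pow {..<n}. r ^ card S * (fourier n f S)\<^sup>2)"
proof -
  have "expect n (\<lambda>x. f x * noise_operator n r f x)
      = expect n (\<lambda>x. \<Sum>S\<in>Pow {..<n}. (r ^ card S * fourier n f S) * (f x * character S x))"
    by (simp add: noise_operator_def multilinear_def sum_distrib_left mult_ac)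
  also have "\<dots> = (\<Sum>S\<in>Pow {..<n}. (r ^ card S * fourier n f S) * fourier n f S)"
    by (simp only: expect_sum expect_cmult fourier_def[symmetric])
  finally show ?thesis by (simp add: power2_eq_square mult_ac)
qed

lemma expect_noise_operator: "expect n (noise_operator n r f) = expect n f"
  unfolding noise_operator_def by (subst expect_multilinear) auto

section \<open>Noise stability in terms of Fourier weights\<close>

lemma set_pmf_resample: "set_pmf (resample \<rho> b) \<subseteq> {-1, 1, b}"
  unfolding resample_def by (auto split: if_splits)

lemma expectation_resample:
  assumes "0 \<le> \<rho>" "\<rho> \<le> 1"
  shows "measure_pmf.expectation (resample \<rho> b) (\<lambda>v. 1 + v * z) = 1 + \<rho> * b * z"
proof -
  have "measure_pmf.expectation (resample \<rho> b) (\<lambda>v. 1 + v * z)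
      = (\<Sum>keep\<in>UNIV. pmf (bernoulli_pmf \<rho>) keep *\<^sub>R measure_pmf.expectation
           (if keep then return_pmf b else pmf_of_set {-1, 1}) (\<lambda>v. 1 + v * z))"
    unfolding resample_def by (rule pmf_expectation_bind) auto
  also have "\<dots> = 1 + \<rho> * b * z"
    using assms by (simp add: UNIV_bool integral_pmf_of_set field_simps)
  finally show ?thesis .
qed

lemma set_pmf_noise: "x \<in> cube n \<Longrightarrow> set_pmf (noise n \<rho> x) \<subseteq> cube n"
proof
  fix y assume x: "x \<in> cube n" and "y \<in> set_pmf (noise n \<rho> x)"
  then have y: "\<And>i. i < n \<Longrightarrow> y i \<in> set_pmf (resample \<rho> (x i))" "\<And>i. \<not> i < n \<Longrightarrow> y i = undefined"
    unfolding noise_def by (auto simp: set_Pi_pmf PiE_dflt_def)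
  have "y i \<in> {-1, 1}" if "i < n" for i
    using y(1)[OF that] set_pmf_resample[of \<rho> "x i"] cube_coord[OF x that] by auto
  then show "y \<in> cube n"
    using y(2) unfolding cube_def by (auto simp: PiE_iff extensional_def)
qed

lemma finite_set_pmf_noise: "x \<in> cube n \<Longrightarrow> finite (set_pmf (noise n \<rho> x))"
  by (rule finite_subset[OF set_pmf_noise finite_cube])

text \<open>Writing \<open>f\<close> by Fourier inversion as an average of product kernels reduces the claim to a single
kernel, whose expectation factorises over the independent coordinates. Each factor \<open>1 + y i * z i\<close>
is nonnegative on the cube, as the product rule for expectations demands.\<close>

lemma expectation_noise:
  assumes \<rho>: "0 \<le> \<rho>" "\<rho> \<le> 1" and x: "x \<in> cube n"
  shows "measure_pmf.expectation (noise n \<rho> x) f = noise_operator n \<rho> f x"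
proof -
  have "measure_pmf.expectation (noise n \<rho> x) f
      = measure_pmf.expectation (noise n \<rho> x) (\<lambda>y. \<Sum>z\<in>cube n. f z / 2 ^ n * (\<Prod>i<n. 1 + y i * z i))"
  proof (rule integral_cong_AE)
    show "AE y in noise n \<rho> x. f y = (\<Sum>z\<in>cube n. f z / 2 ^ n * (\<Prod>i<n. 1 + y i * z i))"
    proof (unfold AE_measure_pmf_iff, intro ballI)
      fix y assume "y \<in> set_pmf (noise n \<rho> x)"
      then have "y \<in> cube n" using set_pmf_noise[OF x] by auto
      from Fourier_inversion_kernel[OF this, of f]
      show "f y = (\<Sum>z\<in>cube n. f z / 2 ^ n * (\<Prod>i<n. 1 + y i * z i))"
        by (simp add: expect_eq sum_divide_distrib)
    qed
  qed auto
  also have "\<dots> = (\<Sum>z\<in>cube n. f z / 2 ^ n *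
      measure_pmf.expectation (noise n \<rho> x) (\<lambda>y. \<Prod>i<n. 1 + y i * z i))"
    using finite_set_pmf_noise[OF x]
    by (subst Bochner_Integration.integral_sum) (auto intro!: integrable_measure_pmf_finite)
  also have "\<dots> = (\<Sum>z\<in>cube n. f z / 2 ^ n * (\<Prod>i<n. 1 + \<rho> * x i * z i))"
  proof (intro sum.cong refl)
    fix z assume z: "z \<in> cube n"
    have fin: "finite (set_pmf (resample \<rho> b))" for b
      by (rule finite_subset[OF set_pmf_resample]) auto
    have nonneg: "0 \<le> 1 + v * z i" if "i < n" "v \<in> set_pmf (resample \<rho> (x i))" for i v
      using that set_pmf_resample[of \<rho> "x i"] cube_coord[OF x \<open>i < n\<close>] cube_coord[OF z \<open>i < n\<close>] by auto
    have "measure_pmf.expectation (noise n \<rho> x) (\<lambda>y. \<Prod>i<n. 1 + y i * z i)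
        = (\<Prod>i<n. measure_pmf.expectation (resample \<rho> (x i)) (\<lambda>v. 1 + v * z i))"
      unfolding noise_def
      by (rule expectation_prod_Pi_pmf) (auto intro!: integrable_measure_pmf_finite fin nonneg)
    then show "f z / 2 ^ n * measure_pmf.expectation (noise n \<rho> x) (\<lambda>y. \<Prod>i<n. 1 + y i * z i)
        = f z / 2 ^ n * (\<Prod>i<n. 1 + \<rho> * x i * z i)"
      by (simp add: expectation_resample[OF \<rho>])
  qed
  also have "\<dots> = noise_operator n \<rho> f x"
    unfolding noise_operator_def fourier_def
    by (subst noise_kernel_expansion) (auto simp: expect_eq sum_divide_distrib)
  finally show ?thesis .
qed

lemma expectation_correlated_pair:
  "measure_pmf.expectation (correlated_pair n \<rho>) F
    = expect n (\<lambda>x. measure_pmf.expectation (noise n \<rho> x) (\<lambda>y. F (x, y)))"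
proof -
  have "measure_pmf.expectation (correlated_pair n \<rho>) F
      = (\<Sum>x\<in>cube n. pmf (pmf_of_set (cube n)) x *\<^sub>R
          measure_pmf.expectation (map_pmf (\<lambda>y. (x, y)) (noise n \<rho> x)) F)"
    unfolding correlated_pair_def
    using cube_nonempty finite_cube finite_set_pmf_noise by (intro pmf_expectation_bind) auto
  then show ?thesis
    using cube_nonempty finite_cube by (simp add: expect_eq card_cube sum_divide_distrib)
qed

lemma noise_stability_Fourier:
  assumes \<rho>: "0 \<le> \<rho>" "\<rho> \<le> 1"
  shows "noise_stability n \<rho> f = (\<Sum>S\<in>Pow {..<n} - {{}}. \<rho> ^ card S * (fourier n f S)\<^sup>2)"
proof -
  have "noise_stability n \<rho> f = expect n (\<lambda>x. f x * noise_operator n \<rho> f x)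
      - expect n f * expect n (noise_operator n \<rho> f)"
    unfolding noise_stability_def pmf_cov_def expectation_correlated_pair
    by (simp add: expectation_noise[OF \<rho>] cong: expect_cong)
  also have "\<dots> = (\<Sum>S\<in>Pow {..<n}. \<rho> ^ card S * (fourier n f S)\<^sup>2) - (expect n f)\<^sup>2"
    by (simp add: expect_times_noise_operator expect_noise_operator power2_eq_square)
  finally show ?thesis
    by (simp add: sum_diff1)
qed

section \<open>Hypercontractivity\<close>

text \<open>The quotient of the two binomial coefficients is the product of the \<open>j\<close> fractions
\<open>(2 m - 2 l - 1) / (2 l + 1)\<close> with \<open>l < j\<close>, each at most \<open>2 m - 1\<close>; this comparison is the
two-point case of hypercontractivity.\<close>

lemma binomial_double_bound:
  assumes "j \<le> m" "0 < m"
  shows "real (2 * m choose (2 * j)) \<le> real (m choose j) * (2 * real m - 1) ^ j"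
  using assms(1)
proof (induction j)
  case (Suc j)
  have step: "real (Suc k) * real (N choose Suc k) = (real N - real k) * real (N choose k)" for N k
    using gbinomial_mult_1[of "real N" k] by (simp add: binomial_gbinomial left_diff_distrib)
  define M J k where "M = real m" and "J = real j" and "k = 2 * M - 1"
  have J: "0 \<le> J" "J + 1 \<le> M" using Suc.prems by (auto simp: J_def M_def)
  define a a1 a2 where "a = real (2 * m choose (2 * j))"
    and "a1 = real (2 * m choose Suc (2 * j))" and "a2 = real (2 * m choose Suc (Suc (2 * j)))"
  define b b1 where "b = real (m choose j)" and "b1 = real (m choose Suc j)"
  have IH: "a \<le> b * k ^ j"
    using Suc by (simp add: a_def b_def k_def M_def)
  have a1: "(2 * J + 1) * a1 = 2 * (M - J) * a"
    using step[of "2 * j" "2 * m"] by (simp add: a_def a1_def J_def M_def algebra_simps)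
  have a2: "2 * (J + 1) * a2 = (2 * M - 2 * J - 1) * a1"
    using step[of "Suc (2 * j)" "2 * m"] by (simp add: a1_def a2_def J_def M_def algebra_simps)
  have b1: "(J + 1) * b1 = (M - J) * b"
    using step[of j m] by (simp add: b_def b1_def J_def M_def algebra_simps)
  have "2 * ((J + 1) * (2 * J + 1) * a2) = (2 * J + 1) * (2 * (J + 1) * a2)"
    by (simp only: mult_ac)
  also have "\<dots> = (2 * M - 2 * J - 1) * ((2 * J + 1) * a1)"
    unfolding a2 by (simp only: mult_ac)
  also have "\<dots> = 2 * ((M - J) * (2 * M - 2 * J - 1) * a)"
    unfolding a1 by (simp only: mult_ac)
  finally have "(J + 1) * (2 * J + 1) * a2 = (M - J) * (2 * M - 2 * J - 1) * a"
    by simp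
  also have "\<dots> \<le> (M - J) * (k * (2 * J + 1)) * (b * k ^ j)"
  proof (intro mult_mono IH order_refl)
    have "2 * M - 2 * J - 1 \<le> k * 1"
      using J by (simp add: k_def)
    also have "k * 1 \<le> k * (2 * J + 1)"
      using J by (intro mult_left_mono) (auto simp: k_def)
    finally show "2 * M - 2 * J - 1 \<le> k * (2 * J + 1)" .
  qed (use J in \<open>auto simp: k_def a_def\<close>)
  also have "\<dots> = (2 * J + 1) * k ^ Suc j * ((M - J) * b)"
    by (simp add: mult_ac)
  also have "\<dots> = (J + 1) * (2 * J + 1) * (b1 * k ^ Suc j)"
    unfolding b1[symmetric] by (simp only: mult_ac)
  finally have "a2 \<le> b1 * k ^ Suc j"
    using J by (simp add: mult_le_cancel_left)
  then show ?case by (simp add: a2_def b1_def k_def M_def)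
qed simp

text \<open>Averaging over the sign of \<open>v\<close> removes the odd terms of the binomial expansion.\<close>

lemma symmetric_binomial:
  fixes u v :: real
  shows "((u + v) ^ (2 * m) + (u - v) ^ (2 * m)) / 2
    = (\<Sum>j\<le>m. real (2 * m choose (2 * j)) * ((u\<^sup>2) ^ (m - j) * (v\<^sup>2) ^ j))"
proof -
  define F where "F k = real (2 * m choose k) * v ^ k * u ^ (2 * m - k)" for k
  have evens: "(\<Sum>k\<le>2 * M. if even k then G k else 0) = (\<Sum>j\<le>M. G (2 * j))" for G :: "nat \<Rightarrow> real" and M
    by (induction M) auto
  have "(u + v) ^ (2 * m) = (\<Sum>k\<le>2 * m. F k)"
    using binomial_ring[of v u "2 * m"] by (simp add: F_def add.commute)
  moreover have "(u - v) ^ (2 * m) = (\<Sum>k\<le>2 * m. (- 1) ^ k * F k)"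
    using binomial_ring[of "- v" u "2 * m"]
    by (simp add: F_def add.commute power_minus[of v] mult_ac)
  ultimately have "((u + v) ^ (2 * m) + (u - v) ^ (2 * m)) / 2 = (\<Sum>k\<le>2 * m. (F k + (- 1) ^ k * F k) / 2)"
    by (simp only: sum.distrib sum_divide_distrib[symmetric])
  also have "\<dots> = (\<Sum>k\<le>2 * m. if even k then F k else 0)"
    by (intro sum.cong) auto
  also have "\<dots> = (\<Sum>j\<le>m. F (2 * j))" by (rule evens)
  also have "\<dots> = (\<Sum>j\<le>m. real (2 * m choose (2 * j)) * ((u\<^sup>2) ^ (m - j) * (v\<^sup>2) ^ j))"
    by (intro sum.cong refl) (simp add: F_def power_mult[symmetric] diff_mult_distrib2)
  finally show ?thesis .
qed

lemma expect_even_power_affine: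
  assumes i: "i < n" and u: "\<And>x b. u (x(i := b)) = u x" and v: "\<And>x b. v (x(i := b)) = v x"
  shows "expect n (\<lambda>x. (u x + x i * v x) ^ (2 * m))
    = (\<Sum>j\<le>m. real (2 * m choose (2 * j)) * expect n (\<lambda>x. ((u x)\<^sup>2) ^ (m - j) * ((v x)\<^sup>2) ^ j))"
proof -
  have "expect n (\<lambda>x. (u x + x i * v x) ^ (2 * m))
      = (expect n (\<lambda>x. (u x + x i * v x) ^ (2 * m)) + expect n (\<lambda>x. (u x - x i * v x) ^ (2 * m))) / 2"
    using expect_flip[OF i, of "\<lambda>x. (u x + x i * v x) ^ (2 * m)"] by (simp add: u v)
  also have "\<dots> = expect n (\<lambda>x. ((u x + x i * v x) ^ (2 * m) + (u x - x i * v x) ^ (2 * m)) / 2)"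
    by (simp add: expect_add expect_divide)
  also have "\<dots> = expect n (\<lambda>x. ((u x + v x) ^ (2 * m) + (u x - v x) ^ (2 * m)) / 2)"
  proof (rule expect_cong)
    fix x assume "x \<in> cube n"
    from cube_coord[OF this i]
    show "((u x + x i * v x) ^ (2 * m) + (u x - x i * v x) ^ (2 * m)) / 2
        = ((u x + v x) ^ (2 * m) + (u x - v x) ^ (2 * m)) / 2"
      by (elim disjE) (simp_all add: add.commute)
  qed
  also have "\<dots> = expect n (\<lambda>x. \<Sum>j\<le>m. real (2 * m choose (2 * j)) * (((u x)\<^sup>2) ^ (m - j) * ((v x)\<^sup>2) ^ j))"
    by (simp add: symmetric_binomial)
  finally show ?thesis by (simp only: expect_sum expect_cmult)
qed

lemma multilinear_update: "i \<notin> A \<Longrightarrow> multilinear A a (x(i := b)) = multilinear A a x"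
  unfolding multilinear_def by (intro sum.cong refl) (subst character_update, auto)

lemma sum_Pow_insert:
  assumes "finite A" "i \<notin> A"
  shows "(\<Sum>S\<in>Pow (insert i A). F S) = (\<Sum>S\<in>Pow A. F S) + (\<Sum>S\<in>Pow A. F (insert i S))"
proof -
  have "inj_on (insert i) (Pow A)" using assms by (auto simp: inj_on_def)
  moreover have "Pow A \<inter> insert i ` Pow A = {}" using assms by auto
  ultimately show ?thesis
    using assms by (simp add: Pow_insert sum.union_disjoint sum.reindex)
qed

lemma multilinear_insert:
  assumes "finite A" "i \<notin> A"
  shows "multilinear (insert i A) a x = multilinear A a x + x i * multilinear A (\<lambda>S. a (insert i S)) x"
proof -
  have "(\<Sum>S\<in>Pow A. a (insert i S) * character (insert i S) x)
      = x i * (\<Sum>S\<in>Pow A. a (insert i S) * character S x)"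
    unfolding sum_distrib_left
  proof (intro sum.cong refl)
    fix S assume "S \<in> Pow A"
    then have "finite S" "i \<notin> S" using assms finite_subset by auto
    then show "a (insert i S) * character (insert i S) x = x i * (a (insert i S) * character S x)"
      by (simp add: character_insert)
  qed
  then show ?thesis
    using assms by (simp add: multilinear_def sum_Pow_insert)
qed

text \<open>The Bonami inequality for even moments, with the noise moved to the right-hand side: the norm of
order \<open>2 m\<close> is at most the \<open>L^2\<close> norm after the coefficient of \<open>S\<close> is multiplied by
\<open>sqrt (2 m - 1) ^ card S\<close>. In the induction on the set of coordinates, the function splits as
\<open>u + x_i v\<close>; only even powers of \<open>x_i\<close> survive in the expectation, Hoelder's inequality separates
\<open>u\<close> from \<open>v\<close>, and \<open>binomial_double_bound\<close> turns the sum back into an \<open>m\<close>-th power.\<close>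

theorem hypercontractivity_even_moments:
  assumes "A \<subseteq> {..<n}" "0 < m"
  shows "expect n (\<lambda>x. multilinear A a x ^ (2 * m)) \<le> (\<Sum>S\<in>Pow A. (2 * real m - 1) ^ card S * (a S)\<^sup>2) ^ m"
proof -
  have "finite A" using assms finite_subset by auto
  then show ?thesis
    using assms(1)
  proof (induction A arbitrary: a)
    case empty
    then show ?case by (simp add: multilinear_def power_mult)
  next
    case (insert i A)
    define k where "k = 2 * real m - 1"
    have k: "1 \<le> k" using assms by (simp add: k_def)
    define u v where "u = multilinear A a" and "v = multilinear A (\<lambda>S. a (insert i S))"
    define p q where "p = (\<Sum>S\<in>Pow A. k ^ card S * (a S)\<^sup>2)"
      and "q = (\<Sum>S\<in>Pow A. k ^ card S * (a (insert i S))\<^sup>2)"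
    have pq: "0 \<le> p" "0 \<le> q" using k by (auto simp: p_def q_def intro!: sum_nonneg)
    have IH: "expect n (\<lambda>x. (multilinear A b x)\<^sup>2 ^ m) \<le> (\<Sum>S\<in>Pow A. k ^ card S * (b S)\<^sup>2) ^ m" for b
      using insert.IH[of b] insert.prems by (simp add: k_def power_mult)
    have "expect n (\<lambda>x. multilinear (insert i A) a x ^ (2 * m)) = expect n (\<lambda>x. (u x + x i * v x) ^ (2 * m))"
      using insert by (simp add: multilinear_insert u_def v_def)
    also have "\<dots> = (\<Sum>j\<le>m. real (2 * m choose (2 * j)) * expect n (\<lambda>x. ((u x)\<^sup>2) ^ (m - j) * ((v x)\<^sup>2) ^ j))"
      using insert by (intro expect_even_power_affine) (auto simp: u_def v_def multilinear_update)
    also have "\<dots> \<le> (\<Sum>j\<le>m. (real (m choose j) * k ^ j) * (p ^ (m - j) * q ^ j))"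
    proof (intro sum_mono mult_mono)
      fix j assume "j \<in> {..m}"
      then show "real (2 * m choose (2 * j)) \<le> real (m choose j) * k ^ j"
        unfolding k_def using assms by (intro binomial_double_bound) auto
      show "expect n (\<lambda>x. ((u x)\<^sup>2) ^ (m - j) * ((v x)\<^sup>2) ^ j) \<le> p ^ (m - j) * q ^ j"
        using \<open>j \<in> {..m}\<close> assms pq IH[of a] IH[of "\<lambda>S. a (insert i S)"]
        by (intro expect_Holder_power) (auto simp: u_def v_def p_def q_def)
    qed (use k in \<open>auto intro!: expect_nonneg\<close>)
    also have "\<dots> = (\<Sum>j\<le>m. real (m choose j) * (k * q) ^ j * p ^ (m - j))"
      by (intro sum.cong) (auto simp: power_mult_distrib)
    also have "\<dots> = (p + k * q) ^ m"
      using binomial_ring[of "k * q" p m] by (simp add: add.commute)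
    also have "p + k * q = (\<Sum>S\<in>Pow (insert i A). k ^ card S * (a S)\<^sup>2)"
    proof -
      have "k * q = (\<Sum>S\<in>Pow A. k ^ card (insert i S) * (a (insert i S))\<^sup>2)"
        unfolding q_def sum_distrib_left
      proof (intro sum.cong refl)
        fix S assume "S \<in> Pow A"
        then have "finite S" "i \<notin> S" using insert finite_subset by auto
        then show "k * (k ^ card S * (a (insert i S))\<^sup>2) = k ^ card (insert i S) * (a (insert i S))\<^sup>2"
          by simp
      qed
      then show ?thesis using insert by (simp add: p_def sum_Pow_insert)
    qed
    finally show ?case by (simp add: k_def)
  qed
qed

section \<open>Directional derivatives of monotone functions\<close>

text \<open>Pairing each point with its flip in coordinate \<open>i\<close> turns the expectation into an average of
increments of \<open>f\<close> in direction \<open>i\<close>, weighted by \<open>h\<close>.\<close>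

lemma monotone_times_coordinate_nonneg:
  assumes mono: "cube_monotone n f" and i: "i < n"
    and indep: "\<And>x b. h (x(i := b)) = h x" and h: "\<And>x. x \<in> cube n \<Longrightarrow> 0 \<le> h x"
  shows "0 \<le> expect n (\<lambda>x. f x * x i * h x)"
proof -
  have "0 \<le> expect n (\<lambda>x. f x * x i * h x + f (x(i := - x i)) * - x i * h x)"
  proof (rule expect_nonneg)
    fix x assume x: "x \<in> cube n"
    have mono_x: "f (x(i := - 1)) \<le> f (x(i := 1))"
      using mono i x unfolding cube_monotone_def by (auto simp: mono_on_def)
    have "0 \<le> (f x - f (x(i := - x i))) * x i"
      using cube_coord[OF x i]
    proof (elim disjE)
      assume xi: "x i = -1"
      then have "x(i := - 1) = x" by auto
      then show ?thesis using mono_x xi by simp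
    next
      assume xi: "x i = 1"
      then have "x(i := 1) = x" by auto
      then show ?thesis using mono_x xi by simp
    qed
    then have "0 \<le> ((f x - f (x(i := - x i))) * x i) * h x"
      using h[OF x] by (rule mult_nonneg_nonneg)
    then show "0 \<le> f x * x i * h x + f (x(i := - x i)) * - x i * h x"
      by (simp add: algebra_simps)
  qed
  also have "\<dots> = expect n (\<lambda>x. f x * x i * h x) + expect n (\<lambda>x. f (x(i := - x i)) * - x i * h x)"
    by (rule expect_add)
  also have "expect n (\<lambda>x. f (x(i := - x i)) * - x i * h x) = expect n (\<lambda>x. f x * x i * h x)"
    using expect_flip[OF i, of "\<lambda>x. f x * x i * h x"] by (simp add: indep)
  finally show ?thesis by simp
qed

text \<open>The multilinear function is the \<open>i\<close>-th discrete derivative of \<open>f\<close> smoothed by noise of rate \<open>r\<close>.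
The noise kernel is nonnegative, so monotonicity of \<open>f\<close> survives the smoothing.\<close>

lemma noisy_derivative_nonneg:
  assumes mono: "cube_monotone n f" and i: "i < n" and r: "0 \<le> r" "r \<le> 1" and x: "x \<in> cube n"
  shows "0 \<le> multilinear ({..<n} - {i}) (\<lambda>S. r ^ card S * fourier n f (insert i S)) x"
proof -
  let ?A = "{..<n} - {i}"
  have "multilinear ?A (\<lambda>S. r ^ card S * fourier n f (insert i S)) x
      = multilinear ?A (\<lambda>S. r ^ card S * expect n (\<lambda>z. (f z * z i) * character S z)) x"
    unfolding multilinear_def
  proof (intro sum.cong refl)
    fix S assume "S \<in> Pow ?A"
    then have "finite S" "i \<notin> S" using finite_subset by auto
    then show "r ^ card S * fourier n f (insert i S) * character S x
        = r ^ card S * expect n (\<lambda>z. f z * z i * character S z) * character S x"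
      by (simp add: fourier_def character_insert mult.assoc)
  qed
  also have "\<dots> = expect n (\<lambda>z. f z * z i * (\<Prod>j\<in>?A. 1 + r * x j * z j))"
    by (rule noise_kernel_expansion) simp
  also have "0 \<le> \<dots>"
  proof (rule monotone_times_coordinate_nonneg[OF mono i])
    show "(\<Prod>j\<in>?A. 1 + r * x j * (z(i := b)) j) = (\<Prod>j\<in>?A. 1 + r * x j * z j)" for z b
      by (intro prod.cong) auto
    show "0 \<le> (\<Prod>j\<in>?A. 1 + r * x j * z j)" if z: "z \<in> cube n" for z
    proof (rule prod_nonneg)
      fix j assume "j \<in> ?A"
      then have "j < n" by auto
      then show "0 \<le> 1 + r * x j * z j"
        using cube_coord[OF x \<open>j < n\<close>] cube_coord[OF z \<open>j < n\<close>] r by auto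
    qed
  qed
  finally show ?thesis .
qed

text \<open>This is the squared \<open>L^2\<close> norm of the \<open>i\<close>-th discrete derivative of \<open>f\<close> after noise of rate
\<open>sqrt s\<close>.\<close>

definition derivative_energy :: "nat \<Rightarrow> ((nat \<Rightarrow> real) \<Rightarrow> real) \<Rightarrow> real \<Rightarrow> nat \<Rightarrow> real" where
  "derivative_energy n f s i
    = (\<Sum>S\<in>Pow ({..<n} - {i}). s ^ card S * (fourier n f (insert i S))\<^sup>2)"

lemma derivative_energy_nonneg: "0 \<le> s \<Longrightarrow> 0 \<le> derivative_energy n f s i"
  unfolding derivative_energy_def by (intro sum_nonneg) auto

text \<open>Interpolation between \<open>L^1\<close> and \<open>L^4\<close> for the smoothed derivative \<open>u\<close>. Because \<open>u\<close> is nonnegative,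
its \<open>L^1\<close> norm is the coefficient of \<open>{i}\<close>; this is where monotonicity brings in the first level.
The factor 3 is the constant \<open>2 m - 1\<close> of hypercontractivity for fourth moments.\<close>

lemma derivative_energy_growth:
  assumes mono: "cube_monotone n f" and i: "i < n" and s: "0 \<le> s" "s \<le> 1"
  shows "derivative_energy n f s i ^ 3 \<le> (fourier n f {i})\<^sup>2 * (derivative_energy n f (3 * s) i)\<^sup>2"
proof -
  define u where "u = multilinear ({..<n} - {i}) (\<lambda>S. sqrt s ^ card S * fourier n f (insert i S))"
  have sq: "(sqrt s ^ k)\<^sup>2 = s ^ k" for k
    using s by (simp add: power_mult[symmetric] mult.commute[of _ 2]) (simp add: power_mult)
  have "expect n (\<lambda>x. (u x)\<^sup>2) ^ 3 \<le> (expect n u)\<^sup>2 * expect n (\<lambda>x. u x ^ 4)"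
    unfolding u_def using s by (intro second_moment_interpolation noisy_derivative_nonneg mono i) auto
  also have "expect n (\<lambda>x. (u x)\<^sup>2) = derivative_energy n f s i"
    unfolding u_def derivative_energy_def by (subst Parseval_multilinear) (auto simp: power_mult_distrib sq)
  also have "expect n u = fourier n f {i}"
    unfolding u_def by (subst expect_multilinear) auto
  also have "expect n (\<lambda>x. u x ^ 4) \<le> (derivative_energy n f (3 * s) i)\<^sup>2"
    using hypercontractivity_even_moments[of "{..<n} - {i}" n 2
        "\<lambda>S. sqrt s ^ card S * fourier n f (insert i S)"]
    by (simp add: u_def derivative_energy_def power_mult_distrib sq mult.assoc)
  finally show ?thesis by (simp add: mult_left_mono)
qed

text \<open>Each set \<open>T\<close> arises as \<open>insert i S\<close> once for every \<open>i \<in> T\<close>.\<close>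

lemma sum_derivative_energy:
  "(\<Sum>i<n. derivative_energy n f s i)
    = (\<Sum>S\<in>Pow {..<n}. real (card S) * s ^ (card S - 1) * (fourier n f S)\<^sup>2)"
proof -
  define G where "G S = s ^ (card S - 1) * (fourier n f S)\<^sup>2" for S
  have "derivative_energy n f s i = (\<Sum>T\<in>Pow {..<n}. if i \<in> T then G T else 0)" if i: "i < n" for i
  proof -
    have "derivative_energy n f s i = (\<Sum>T\<in>{T \<in> Pow {..<n}. i \<in> T}. G T)"
      unfolding derivative_energy_def
    proof (rule sum.reindex_bij_witness[of _ "\<lambda>T. T - {i}" "insert i"])
      fix S assume S: "S \<in> Pow ({..<n} - {i})"
      then have "finite S" "i \<notin> S" using finite_subset by auto
      then show "G (insert i S) = s ^ card S * (fourier n f (insert i S))\<^sup>2"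
        by (simp add: G_def)
    qed (use i in auto)
    then show ?thesis by (simp only: sum.inter_filter finite_Pow_iff finite_lessThan)
  qed
  then have "(\<Sum>i<n. derivative_energy n f s i) = (\<Sum>T\<in>Pow {..<n}. \<Sum>i<n. if i \<in> T then G T else 0)"
    by (simp add: sum.swap[of _ "{..<n}"])
  also have "\<dots> = (\<Sum>T\<in>Pow {..<n}. real (card T) * G T)"
  proof (intro sum.cong refl)
    fix T assume "T \<in> Pow {..<n}"
    then have "{i \<in> {..<n}. i \<in> T} = T" by auto
    then show "(\<Sum>i<n. if i \<in> T then G T else 0) = real (card T) * G T"
      by (simp add: sum.inter_filter[symmetric])
  qed
  finally show ?thesis by (simp add: G_def mult.assoc)
qed

lemma cube_le_square_mult_imp_AM_GM:
  fixes p x y t :: real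
  assumes "p ^ 3 \<le> x * y\<^sup>2" "0 \<le> x" "0 \<le> y" "0 < t"
  shows "3 * p \<le> t\<^sup>2 * x + 2 * y / t"
proof -
  define X Y where "X = t\<^sup>2 * x" and "Y = y / t"
  have XY: "0 \<le> X" "0 \<le> Y" using assms by (auto simp: X_def Y_def)
  have "x * y\<^sup>2 = X * Y\<^sup>2"
    using assms by (simp add: X_def Y_def power_divide)
  then have p: "p ^ 3 \<le> X * Y\<^sup>2" using assms by simp
  have "0 \<le> (X - Y)\<^sup>2 * (X + 8 * Y)" using XY by simp
  also have "\<dots> = (X + 2 * Y) ^ 3 - 27 * (X * Y\<^sup>2)"
    by (simp add: power2_eq_square power3_eq_cube algebra_simps)
  finally have "(3 * p) ^ 3 \<le> (X + 2 * Y) ^ 3"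
    using p by (simp add: power_mult_distrib)
  then have "3 * p \<le> X + 2 * Y"
    using XY by (metis add_nonneg_nonneg mult_nonneg_nonneg not_le power_strict_mono zero_le_numeral zero_less_numeral)
  then show ?thesis by (simp add: X_def Y_def)
qed

text \<open>Hoelder's inequality with exponents 3 and 3/2, obtained from the weighted AM-GM inequality with
a free parameter \<open>t\<close> that is the same for all summands.\<close>

lemma Holder_sum_cubes:
  fixes p x y :: "'a \<Rightarrow> real"
  assumes le: "\<And>i. i \<in> I \<Longrightarrow> p i ^ 3 \<le> x i * (y i)\<^sup>2"
    and nonneg: "\<And>i. i \<in> I \<Longrightarrow> 0 \<le> x i" "\<And>i. i \<in> I \<Longrightarrow> 0 \<le> y i" and pos: "0 < (\<Sum>i\<in>I. p i)"
  shows "(\<Sum>i\<in>I. p i) ^ 3 \<le> (\<Sum>i\<in>I. x i) * (\<Sum>i\<in>I. y i)\<^sup>2"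
proof -
  define P X Y where "P = (\<Sum>i\<in>I. p i)" and "X = (\<Sum>i\<in>I. x i)" and "Y = (\<Sum>i\<in>I. y i)"
  have bound: "3 * P \<le> t\<^sup>2 * X + 2 * Y / t" if "0 < t" for t
  proof -
    have "(\<Sum>i\<in>I. 3 * p i) \<le> (\<Sum>i\<in>I. t\<^sup>2 * x i + 2 * y i / t)"
      using that le nonneg by (intro sum_mono cube_le_square_mult_imp_AM_GM) auto
    then show ?thesis
      by (simp add: P_def X_def Y_def sum.distrib sum_distrib_left sum_divide_distrib)
  qed
  have "0 \<le> Y" unfolding Y_def using nonneg by (intro sum_nonneg)
  have "Y \<noteq> 0"
  proof
    assume "Y = 0"
    then have "y i = 0" if "i \<in> I" "finite I" for i
      using nonneg that by (simp add: Y_def sum_nonneg_eq_0_iff)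
    then have "p i ^ 3 \<le> 0" if "i \<in> I" "finite I" for i
      using le[of i] that by simp
    then have "p i \<le> 0" if "i \<in> I" "finite I" for i
      using that by (meson not_le zero_less_power)
    then have "P \<le> 0"
      unfolding P_def by (cases "finite I") (auto intro!: sum_nonpos)
    then show False using pos by (simp add: P_def)
  qed
  with \<open>0 \<le> Y\<close> have Y: "0 < Y" by simp
  have P: "0 < P" using pos by (simp add: P_def)
  \<comment> \<open>With \<open>t = Y / P\<close> the last summand becomes \<open>2 P\<close>, which is absorbed on the left.\<close>
  have "3 * P \<le> (Y / P)\<^sup>2 * X + 2 * Y / (Y / P)"
    using Y P by (intro bound) simp
  also have "\<dots> = X * Y\<^sup>2 / P\<^sup>2 + 2 * P"
    using Y P by (simp add: power_divide)
  finally have "P \<le> X * Y\<^sup>2 / P\<^sup>2" by simp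
  then have "P * P\<^sup>2 \<le> X * Y\<^sup>2"
    using P by (simp add: pos_le_divide_eq)
  then show ?thesis
    by (simp add: P_def X_def Y_def power3_eq_cube power2_eq_square mult.assoc)
qed

lemma fourier1_eq: "fourier1 n f i = fourier n f {i}"
  by (simp add: fourier1_def fourier_def)

lemma total_derivative_energy_growth:
  assumes mono: "cube_monotone n f" and s: "0 \<le> s" "s \<le> 1"
    and pos: "0 < (\<Sum>i<n. derivative_energy n f s i)"
  shows "(\<Sum>i<n. derivative_energy n f s i) ^ 3
    \<le> W1 n f * (\<Sum>i<n. derivative_energy n f (3 * s) i)\<^sup>2"
  unfolding W1_def fourier1_eq using s mono pos
  by (intro Holder_sum_cubes derivative_energy_growth) (auto intro!: derivative_energy_nonneg)

section \<open>Noise stability and the first-level weight\<close>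

text \<open>Noise stability vanishes at rate 0, and its derivative, the total derivative energy, increases
with the rate. In Fourier terms this is \<open>1 \<le> card S\<close> for nonempty \<open>S\<close>.\<close>

lemma noise_stability_le_derivative_energy:
  assumes \<rho>: "0 \<le> \<rho>" "\<rho> \<le> 1"
  shows "noise_stability n \<rho> f \<le> \<rho> * (\<Sum>i<n. derivative_energy n f \<rho> i)"
proof -
  have "noise_stability n \<rho> f
      \<le> (\<Sum>S\<in>Pow {..<n} - {{}}. \<rho> * (real (card S) * \<rho> ^ (card S - 1) * (fourier n f S)\<^sup>2))"
    unfolding noise_stability_Fourier[OF \<rho>]
  proof (intro sum_mono)
    fix S assume S: "S \<in> Pow {..<n} - {{}}"
    then have "0 < card S" using finite_subset by (auto simp: card_gt_0_iff)
    then obtain k where k: "card S = Suc k" by (cases "card S") auto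
    have "1 * (\<rho> ^ card S * (fourier n f S)\<^sup>2) \<le> real (card S) * (\<rho> ^ card S * (fourier n f S)\<^sup>2)"
      using \<rho> k by (intro mult_right_mono) auto
    then show "\<rho> ^ card S * (fourier n f S)\<^sup>2
        \<le> \<rho> * (real (card S) * \<rho> ^ (card S - 1) * (fourier n f S)\<^sup>2)"
      by (simp add: k mult_ac)
  qed
  also have "\<dots> \<le> (\<Sum>S\<in>Pow {..<n}. \<rho> * (real (card S) * \<rho> ^ (card S - 1) * (fourier n f S)\<^sup>2))"
    using \<rho> by (intro sum_mono2) auto
  finally show ?thesis
    by (simp add: sum_derivative_energy sum_distrib_left)
qed

text \<open>Doubling the rate pays for the factor \<open>card S \<le> 2 ^ card S\<close> of the derivative.\<close>

lemma derivative_energy_le_noise_energy: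
  assumes "0 \<le> s"
  shows "s * (\<Sum>i<n. derivative_energy n f s i) \<le> (\<Sum>S\<in>Pow {..<n}. (2 * s) ^ card S * (fourier n f S)\<^sup>2)"
  unfolding sum_derivative_energy sum_distrib_left
proof (intro sum_mono)
  fix S :: "nat set"
  have "s * (real (card S) * s ^ (card S - 1)) = real (card S) * s ^ card S"
    by (cases "card S") auto
  also have "\<dots> \<le> 2 ^ card S * s ^ card S"
  proof (intro mult_right_mono)
    have "card S \<le> 2 ^ card S" using less_exp[of "card S"] by simp
    then show "real (card S) \<le> 2 ^ card S"
      by (metis of_nat_le_iff of_nat_numeral of_nat_power)
  qed (use assms in auto)
  finally have "s * (real (card S) * s ^ (card S - 1)) \<le> (2 * s) ^ card S"
    by (simp add: power_mult_distrib)
  then show "s * (real (card S) * s ^ (card S - 1) * (fourier n f S)\<^sup>2) \<le> (2 * s) ^ card S * (fourier n f S)\<^sup>2"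
    by (simp add: mult.assoc[symmetric] mult_right_mono)
qed

text \<open>Small sets are noise sensitive. The left-hand sum \<open>Q\<close> is the correlation of \<open>f\<close> with its noisy
version. The power mean over the support of \<open>f\<close> and hypercontractivity for moments of order \<open>2 m\<close>
bound \<open>Q ^ (2 m)\<close> by \<open>\<mu> ^ (2 m - 1) * Q ^ m\<close>, where \<open>\<mu>\<close> is the mean of \<open>f\<close>.\<close>

lemma noise_energy_small_set:
  assumes f: "f \<in> cube n \<rightarrow> {0, 1}" and m: "0 < m" and s: "0 \<le> s" "(2 * real m - 1) * s \<le> 1"
  shows "(\<Sum>S\<in>Pow {..<n}. s ^ card S * (fourier n f S)\<^sup>2) ^ m \<le> expect n f ^ (2 * m - 1)"
proof -
  define Q where "Q = (\<Sum>S\<in>Pow {..<n}. s ^ card S * (fourier n f S)\<^sup>2)"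
  have Q: "0 \<le> Q" unfolding Q_def using s by (intro sum_nonneg) auto
  have mu: "0 \<le> expect n f"
    using indicator_cases[OF f] by (intro expect_nonneg) force
  have "Q ^ (2 * m) = expect n (\<lambda>x. f x * noise_operator n s f x) ^ (2 * m)"
    by (simp add: Q_def expect_times_noise_operator)
  also have "\<dots> \<le> expect n f ^ (2 * m - 1) * expect n (\<lambda>x. noise_operator n s f x ^ (2 * m))"
    using m by (intro indicator_power_mean f) auto
  also have "\<dots> \<le> expect n f ^ (2 * m - 1) * Q ^ m"
  proof (intro mult_left_mono)
    have "expect n (\<lambda>x. noise_operator n s f x ^ (2 * m))
        \<le> (\<Sum>S\<in>Pow {..<n}. (2 * real m - 1) ^ card S * (s ^ card S * fourier n f S)\<^sup>2) ^ m"
      unfolding noise_operator_def using m by (intro hypercontractivity_even_moments) auto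
    also have "\<dots> \<le> Q ^ m"
      unfolding Q_def
    proof (intro power_mono sum_mono)
      fix S :: "nat set"
      have "((2 * real m - 1) * s) ^ card S \<le> 1"
        using s m by (intro power_le_one) auto
      then have "((2 * real m - 1) * s) ^ card S * (s ^ card S * (fourier n f S)\<^sup>2)
          \<le> 1 * (s ^ card S * (fourier n f S)\<^sup>2)"
        using s by (intro mult_right_mono) auto
      then show "(2 * real m - 1) ^ card S * (s ^ card S * fourier n f S)\<^sup>2 \<le> s ^ card S * (fourier n f S)\<^sup>2"
        by (simp add: power_mult_distrib power2_eq_square mult_ac)
    qed (use s m in \<open>auto intro!: sum_nonneg\<close>)
    finally show "expect n (\<lambda>x. noise_operator n s f x ^ (2 * m)) \<le> Q ^ m" .
  qed (use mu in auto)
  finally have "Q ^ m * Q ^ m \<le> expect n f ^ (2 * m - 1) * Q ^ m"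
    by (simp add: mult_2 power_add)
  then show ?thesis
    using Q mu m unfolding Q_def[symmetric]
    by (cases "Q = 0") (auto simp: zero_power mult_le_cancel_right)
qed

lemma ln_inverse_measure_ge:
  fixes \<mu> :: real
  assumes "0 < \<mu>" "\<mu> \<le> 1 / 2"
  shows "2 / 3 \<le> ln (1 / \<mu>)"
proof -
  have "2 / 3 \<le> ln (2::real)" by (rule ln2_ge_two_thirds)
  also have "ln (2::real) \<le> ln (1 / \<mu>)"
    using assms by (intro ln_mono) (auto simp: field_simps)
  finally show ?thesis .
qed

text \<open>Moments of order \<open>2 m\<close> close to \<open>ln (1 / \<mu>)\<close> make the loss \<open>\<mu> powr (-1 / (2 m))\<close> in the power mean over
a set of measure \<open>\<mu>\<close> a constant factor.\<close>

lemma moment_order: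
  fixes \<mu> :: real
  assumes "0 < \<mu>" "\<mu> \<le> 1 / 2"
  obtains m :: nat where "0 < m" "2 * real m - 1 \<le> 5 / 2 * ln (1 / \<mu>)" "1 \<le> \<mu> * exp 1 ^ (2 * m)"
proof
  define L where "L = ln (1 / \<mu>)"
  have L: "2 / 3 \<le> L" unfolding L_def using assms by (rule ln_inverse_measure_ge)
  define m where "m = nat \<lceil>L / 2\<rceil>"
  have m: "L / 2 \<le> real m" "real m < L / 2 + 1"
    unfolding m_def using L by linarith+
  show "0 < m" using m L by (cases m) auto
  show "2 * real m - 1 \<le> 5 / 2 * ln (1 / \<mu>)"
    using m L unfolding L_def[symmetric] by linarith
  have "1 / \<mu> = exp L" using assms by (simp add: L_def)
  also have "\<dots> \<le> exp (2 * real m)" using m by simp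
  also have "\<dots> = exp 1 ^ (2 * m)" by (simp add: exp_of_nat_mult[symmetric])
  finally show "1 \<le> \<mu> * exp 1 ^ (2 * m)"
    using assms by (simp add: field_simps)
qed

text \<open>With \<open>D = L \<mu>^2\<close>, the energy \<open>\<Phi>\<close> is at least \<open>15 \<alpha> D\<close> at \<open>\<rho>\<close> by stability and at most \<open>5 e^2 D\<close> at
\<open>3 \<rho>\<close> because \<open>f\<close> has small support; since \<open>\<Phi>(\<rho>)^3 \<le> W1 * \<Phi>(3 \<rho>)^2\<close>, the weight \<open>W1\<close> is at least
\<open>135 \<alpha>^3 D / e^4\<close>.\<close>

theorem first_level_weight_lower_bound:
  assumes f: "f \<in> cube n \<rightarrow> {0, 1}" and mono: "cube_monotone n f"
    and mu: "0 < expect n f" "expect n f \<le> 1 / 2" and \<alpha>: "0 < \<alpha>"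
    and stable: "\<alpha> * (expect n f)\<^sup>2 \<le> noise_stability n (1 / 15 / ln (1 / expect n f)) f"
  shows "135 * \<alpha> ^ 3 / (exp 2)\<^sup>2 * (expect n f)\<^sup>2 * ln (1 / expect n f) \<le> W1 n f"
proof -
  define \<mu> L \<rho> where "\<mu> = expect n f" and "L = ln (1 / \<mu>)" and "\<rho> = 1 / 15 / L"
  have L: "2 / 3 \<le> L" unfolding L_def using mu by (intro ln_inverse_measure_ge) (auto simp: \<mu>_def)
  have \<rho>: "0 < \<rho>" "\<rho> \<le> 1" using L by (auto simp: \<rho>_def divide_simps)
  define D where "D = L * \<mu>\<^sup>2"
  have D: "0 < D" using L mu by (simp add: D_def \<mu>_def)
  define \<Phi> where "\<Phi> s = (\<Sum>i<n. derivative_energy n f s i)" for s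
  have "\<alpha> * \<mu>\<^sup>2 \<le> \<rho> * \<Phi> \<rho>"
    using stable noise_stability_le_derivative_energy[of \<rho> n f] \<rho> by (simp add: \<Phi>_def \<rho>_def L_def \<mu>_def)
  then have lower: "15 * \<alpha> * D \<le> \<Phi> \<rho>"
    using L by (simp add: \<rho>_def D_def field_simps)
  have upper: "\<Phi> (3 * \<rho>) \<le> 5 * exp 2 * D"
  proof -
    obtain m where m: "0 < m" "2 * real m - 1 \<le> 5 / 2 * L" "1 \<le> \<mu> * exp 1 ^ (2 * m)"
      using moment_order[of \<mu>] mu unfolding L_def \<mu>_def by auto
    define Q where "Q = (\<Sum>S\<in>Pow {..<n}. (6 * \<rho>) ^ card S * (fourier n f S)\<^sup>2)"
    have "Q ^ m \<le> \<mu> ^ (2 * m - 1)"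
      unfolding Q_def \<mu>_def
    proof (rule noise_energy_small_set[OF f m(1)])
      \<comment> \<open>This requirement dictates \<open>\<rho> = 1 / (15 L)\<close>: tripling \<open>\<rho>\<close> is the price of fourth moments,
        doubling it that of the derivative.\<close>
      have "(2 * real m - 1) * (6 * \<rho>) \<le> 5 / 2 * L * (6 * \<rho>)"
        using m \<rho> by (intro mult_right_mono) auto
      also have "\<dots> = 1" using L by (simp add: \<rho>_def)
      finally show "(2 * real m - 1) * (6 * \<rho>) \<le> 1" .
    qed (use \<rho> in auto)
    also have "\<mu> ^ (2 * m - 1) * 1 \<le> \<mu> ^ (2 * m - 1) * (\<mu> * exp 1 ^ (2 * m))"
      using m mu by (intro mult_left_mono) (auto simp: \<mu>_def)
    then have "\<mu> ^ (2 * m - 1) \<le> \<mu> ^ (2 * m) * exp 1 ^ (2 * m)"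
      using m by (cases m) (auto simp: mult_ac)
    also have "\<mu> ^ (2 * m) * exp 1 ^ (2 * m) = (\<mu>\<^sup>2 * exp 2) ^ m"
      by (simp add: power_mult power_mult_distrib exp_of_nat_mult[symmetric])
    finally have "Q \<le> \<mu>\<^sup>2 * exp 2"
      using m(1) by (meson not_le power_strict_mono mult_nonneg_nonneg zero_le_power2 exp_ge_zero)
    moreover have "3 * \<rho> * \<Phi> (3 * \<rho>) \<le> Q"
      using derivative_energy_le_noise_energy[of "3 * \<rho>" n f] \<rho> by (simp add: \<Phi>_def Q_def)
    ultimately have "3 * \<rho> * \<Phi> (3 * \<rho>) \<le> \<mu>\<^sup>2 * exp 2" by simp
    then show ?thesis using L by (simp add: \<rho>_def D_def field_simps)
  qed
  have pos: "0 < \<Phi> \<rho>" using lower D \<alpha> by (smt (verit) mult_pos_pos)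
  have "(15 * \<alpha> * D) ^ 3 \<le> \<Phi> \<rho> ^ 3"
    using lower \<alpha> D by (intro power_mono) auto
  also have "\<dots> \<le> W1 n f * (\<Phi> (3 * \<rho>))\<^sup>2"
    unfolding \<Phi>_def using \<rho> pos by (intro total_derivative_energy_growth mono) (auto simp: \<Phi>_def)
  also have "\<dots> \<le> W1 n f * (5 * exp 2 * D)\<^sup>2"
  proof (intro mult_left_mono power_mono upper)
    show "0 \<le> \<Phi> (3 * \<rho>)"
      unfolding \<Phi>_def using \<rho> by (intro sum_nonneg derivative_energy_nonneg) auto
    show "0 \<le> W1 n f" unfolding W1_def by (intro sum_nonneg) auto
  qed
  finally have "(25 * D\<^sup>2) * (135 * \<alpha> ^ 3 * D) \<le> (25 * D\<^sup>2) * (W1 n f * (exp 2)\<^sup>2)"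
    by (simp add: power_mult_distrib power2_eq_square power3_eq_cube mult_ac)
  then have "135 * \<alpha> ^ 3 * D \<le> W1 n f * (exp 2)\<^sup>2"
    by (rule mult_left_le_imp_le) (use D in simp)
  then have "135 * \<alpha> ^ 3 * D / (exp 2)\<^sup>2 \<le> W1 n f"
    by (simp add: pos_divide_le_eq)
  then show ?thesis
    by (simp add: D_def L_def \<mu>_def mult_ac)
qed

section \<open>From first-level weight to a correlated halfspace\<close>

text \<open>Coefficients of a linear form, so that hypercontractivity applies to it.\<close>

definition linear_coeff :: "(nat \<Rightarrow> real) \<Rightarrow> nat set \<Rightarrow> real" where
  "linear_coeff b S = (if card S = 1 then b (the_elem S) else 0)"

lemma sum_Pow_singletons:
  fixes F :: "nat set \<Rightarrow> real"
  assumes "\<And>S. card S \<noteq> 1 \<Longrightarrow> F S = 0"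
  shows "(\<Sum>S\<in>Pow {..<n}. F S) = (\<Sum>i<n. F {i})"
proof -
  have "(\<Sum>S\<in>Pow {..<n}. F S) = (\<Sum>S\<in>(\<lambda>i. {i}) ` {..<n}. F S)"
    using assms by (intro sum.mono_neutral_right) (auto simp: card_1_singleton_iff)
  then show ?thesis by (simp add: sum.reindex)
qed

lemma multilinear_linear_coeff: "multilinear {..<n} (linear_coeff b) x = (\<Sum>i<n. b i * x i)"
  unfolding multilinear_def by (subst sum_Pow_singletons) (auto simp: linear_coeff_def)

lemma linear_form_even_moment:
  assumes "0 < m"
  shows "expect n (\<lambda>x. (\<Sum>i<n. b i * x i) ^ (2 * m)) \<le> ((2 * real m - 1) * (\<Sum>i<n. (b i)\<^sup>2)) ^ m"
proof -
  have "(\<Sum>S\<in>Pow {..<n}. (2 * real m - 1) ^ card S * (linear_coeff b S)\<^sup>2)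
      = (2 * real m - 1) * (\<Sum>i<n. (b i)\<^sup>2)"
    by (subst sum_Pow_singletons) (auto simp: linear_coeff_def sum_distrib_left)
  then show ?thesis
    using hypercontractivity_even_moments[of "{..<n}" n m "linear_coeff b"] assms
    by (simp add: multilinear_linear_coeff)
qed

lemma linear_form_mean: "expect n (\<lambda>x. \<Sum>i<n. b i * x i) = 0"
  using expect_coordinate_times[of _ n "\<lambda>_. 1"] by (simp add: expect_sum expect_cmult)

text \<open>A unit linear form has subgaussian moments, so its mean square over a set of measure \<open>\<mu>\<close> is
\<open>O(ln (1 / \<mu>))\<close>: take the power mean of order \<open>2 m\<close> of its square and use its moment of order
\<open>4 m\<close>.\<close>

lemma linear_form_second_moment_on_small_set:
  assumes f: "f \<in> cube n \<rightarrow> {0, 1}" and mu: "0 < expect n f" "expect n f \<le> 1 / 2"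
    and b: "(\<Sum>i<n. (b i)\<^sup>2) = 1"
  shows "expect n (\<lambda>x. f x * (\<Sum>i<n. b i * x i)\<^sup>2) \<le> 18 * ln (1 / expect n f) * expect n f"
proof -
  define \<mu> L where "\<mu> = expect n f" and "L = ln (1 / \<mu>)"
  have L: "2 / 3 \<le> L" unfolding L_def using mu by (intro ln_inverse_measure_ge) (auto simp: \<mu>_def)
  define M where "M = expect n (\<lambda>x. f x * (\<Sum>i<n. b i * x i)\<^sup>2)"
  obtain m where m: "0 < m" "2 * real m - 1 \<le> 5 / 2 * L" "1 \<le> \<mu> * exp 1 ^ (2 * m)"
    using moment_order[of \<mu>] mu unfolding L_def \<mu>_def by auto
  define k where "k = 4 * real m - 1"
  have k: "0 \<le> k" "k \<le> 13 / 2 * L" using m L by (auto simp: k_def)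
  have "M ^ (2 * m) \<le> \<mu> ^ (2 * m - 1) * expect n (\<lambda>x. ((\<Sum>i<n. b i * x i)\<^sup>2) ^ (2 * m))"
    unfolding M_def \<mu>_def using m by (intro indicator_power_mean f) auto
  also have "\<dots> \<le> \<mu> ^ (2 * m - 1) * k ^ (2 * m)"
    using linear_form_even_moment[of "2 * m" n b] m mu
    by (intro mult_left_mono) (auto simp: b k_def \<mu>_def power_mult[symmetric])
  also have "\<dots> * 1 \<le> \<mu> ^ (2 * m - 1) * k ^ (2 * m) * (\<mu> * exp 1 ^ (2 * m))"
    using m mu k by (intro mult_left_mono) (auto simp: \<mu>_def)
  also have "\<dots> = (exp 1 * k * \<mu>) ^ (2 * m)"
    using m by (cases m) (auto simp: power_mult_distrib mult_ac)
  finally have "M ^ (2 * m) \<le> (exp 1 * k * \<mu>) ^ (2 * m)" by simp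
  moreover have "0 \<le> exp 1 * k * \<mu>" using k mu by (simp add: \<mu>_def)
  ultimately have "M \<le> exp 1 * k * \<mu>"
    using m(1) by (meson not_le power_strict_mono mult_pos_pos zero_less_numeral)
  also have "\<dots> \<le> 272 / 100 * (13 / 2 * L) * \<mu>"
    using k mu e_less_272 by (intro mult_mono) (auto simp: \<mu>_def)
  also have "\<dots> \<le> 18 * L * \<mu>"
    using L mu by (intro mult_right_mono) (auto simp: \<mu>_def)
  finally show ?thesis by (simp add: M_def L_def \<mu>_def)
qed

definition truncate :: "real \<Rightarrow> real \<Rightarrow> real" where
  "truncate T v = max (- T) (min T v)"

text \<open>Layer-cake formula; the two integrands agree except possibly at \<open>t = truncate T v\<close>.\<close>

lemma truncate_has_integral:
  assumes "0 < T"
  shows "((\<lambda>t. of_bool (t < v)) has_integral (truncate T v + T)) {- T..T}"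
proof -
  define c where "c = truncate T v"
  have c: "- T \<le> c" "c \<le> T" using assms by (auto simp: c_def truncate_def)
  have "((\<lambda>t. 1::real) has_integral (c + T)) {- T..c}"
    using has_integral_const_real[of "1::real" "- T" c] c by simp
  then have "((\<lambda>t. if t \<in> {- T..c} then 1 else 0::real) has_integral (c + T)) {- T..T}"
    using c by (subst has_integral_restrict) auto
  then have "((\<lambda>t. of_bool (t < v)) has_integral (c + T)) {- T..T}"
    by (rule has_integral_spike_finite[of "{c}", rotated 2]) (auto simp: c_def truncate_def)
  then show ?thesis by (simp add: c_def)
qed

lemma truncate_error:
  assumes "0 < T"
  shows "\<bar>v - truncate T v\<bar> \<le> v\<^sup>2 / T"
proof (cases "\<bar>v\<bar> \<le> T")
  case True
  then show ?thesis using assms by (auto simp: truncate_def)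
next
  case False
  have "\<bar>v - truncate T v\<bar> \<le> \<bar>v\<bar>"
    using False assms by (auto simp: truncate_def)
  also have "\<bar>v\<bar> * T \<le> \<bar>v\<bar> * \<bar>v\<bar>"
    using False by (intro mult_left_mono) auto
  then have "\<bar>v\<bar> \<le> v\<^sup>2 / T"
    using assms by (simp add: pos_le_divide_eq power2_eq_square)
  finally show ?thesis .
qed

lemma cov_eq: "cov n f g = expect n (\<lambda>x. f x * g x) - expect n f * expect n g"
  by (simp add: cov_def pmf_cov_def expectation_uniform_cube)

lemma cov_eq_sum: "cov n f g = (\<Sum>x\<in>cube n. (f x - expect n f) / 2 ^ n * g x)"
proof -
  have "cov n f g = expect n (\<lambda>x. (f x - expect n f) * g x)"
    by (simp add: cov_eq left_diff_distrib expect_diff expect_cmult)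
  then show ?thesis by (simp add: expect_eq sum_divide_distrib)
qed

text \<open>By the layer-cake formula, the covariance of \<open>f\<close> with the truncation is an average of its covariances
with the superlevel sets, multiplied by the length \<open>2 T\<close> of the range of thresholds.\<close>

lemma cov_truncate_le:
  assumes T: "0 < T" and le: "\<And>t. cov n f (\<lambda>x. of_bool (t < v x)) \<le> \<kappa>"
  shows "cov n f (\<lambda>x. truncate T (v x)) \<le> 2 * T * \<kappa>"
proof -
  have "((\<lambda>t. cov n f (\<lambda>x. of_bool (t < v x))) has_integral cov n f (\<lambda>x. truncate T (v x) + T)) {- T..T}"
    unfolding cov_eq_sum
    by (intro has_integral_sum finite_cube has_integral_mult_right truncate_has_integral T)
  moreover have "((\<lambda>t. \<kappa>) has_integral (2 * T * \<kappa>)) {- T..T}"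
    using has_integral_const_real[of \<kappa> "- T" T] T by simp
  ultimately have "cov n f (\<lambda>x. truncate T (v x) + T) \<le> 2 * T * \<kappa>"
    by (rule has_integral_le) (rule le)
  moreover have "cov n f (\<lambda>x. truncate T (v x) + T) = cov n f (\<lambda>x. truncate T (v x))"
    by (simp add: cov_eq distrib_left expect_add expect_multc)
  ultimately show ?thesis by simp
qed

text \<open>The truncation of the linear form \<open>v\<close> at height \<open>T\<close> differs from \<open>v\<close> by at most \<open>v^2 / T\<close>. This error
enters twice: in the correlation with \<open>f\<close>, and in the mean of the truncation, which has to be
subtracted to pass to the covariance and would be zero for \<open>v\<close> itself.\<close>

lemma linear_correlation_le:
  assumes f: "f \<in> cube n \<rightarrow> {0, 1}" and b: "(\<Sum>i<n. (b i)\<^sup>2) = 1" and T: "0 < T"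
    and le: "\<And>t. cov n f (\<lambda>x. of_bool (t < (\<Sum>i<n. b i * x i))) \<le> \<kappa>"
  shows "expect n (\<lambda>x. f x * (\<Sum>i<n. b i * x i))
    \<le> 2 * T * \<kappa> + (expect n (\<lambda>x. f x * (\<Sum>i<n. b i * x i)\<^sup>2) + expect n f) / T"
proof -
  define v where "v x = (\<Sum>i<n. b i * x i)" for x :: "nat \<Rightarrow> real"
  define h where "h x = truncate T (v x)" for x
  have err: "\<bar>v x - h x\<bar> \<le> (v x)\<^sup>2 / T" for x
    unfolding h_def by (rule truncate_error[OF T])
  have mu: "0 \<le> expect n f"
    using indicator_cases[OF f] by (intro expect_nonneg) force
  have v2: "expect n (\<lambda>x. (v x)\<^sup>2) \<le> 1"
    using linear_form_even_moment[of 1 n b] by (simp add: v_def b)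
  have "expect n h = expect n (\<lambda>x. h x - v x)"
    using linear_form_mean[of n b] by (simp add: expect_diff v_def)
  also have "\<dots> \<le> expect n (\<lambda>x. (v x)\<^sup>2 / T)"
    using err by (intro expect_mono) (smt (verit))
  also have "\<dots> \<le> 1 / T"
    using v2 T by (simp add: expect_divide divide_right_mono)
  finally have Eh: "expect n h \<le> 1 / T" .
  have "expect n (\<lambda>x. f x * v x) = expect n (\<lambda>x. f x * h x) + expect n (\<lambda>x. f x * (v x - h x))"
    by (simp add: expect_add[symmetric] algebra_simps)
  also have "expect n (\<lambda>x. f x * (v x - h x)) \<le> expect n (\<lambda>x. f x * (v x)\<^sup>2 / T)"
  proof (rule expect_mono)
    fix x assume "x \<in> cube n"
    have "v x - h x \<le> (v x)\<^sup>2 / T" using err[of x] by simp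
    then show "f x * (v x - h x) \<le> f x * (v x)\<^sup>2 / T"
      using indicator_cases[OF f \<open>x \<in> cube n\<close>] by auto
  qed
  also have "expect n (\<lambda>x. f x * h x) = cov n f h + expect n f * expect n h"
    by (simp add: cov_eq)
  also have "cov n f h \<le> 2 * T * \<kappa>"
    unfolding h_def using le by (intro cov_truncate_le T) (simp add: v_def)
  also have "expect n f * expect n h \<le> expect n f * (1 / T)"
    using Eh mu by (rule mult_left_mono)
  finally show ?thesis
    by (simp add: v_def expect_divide add_divide_distrib)
qed

text \<open>Apply \<open>linear_correlation_le\<close> to the normalised linear part of \<open>f\<close>, whose correlation with \<open>f\<close> is
\<open>sqrt W1\<close>. The height is proportional to \<open>sqrt L\<close>, the typical size of the linear form on the support
of \<open>f\<close>.\<close>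

theorem correlated_halfspace_exists:
  assumes f: "f \<in> cube n \<rightarrow> {0, 1}" and mu: "0 < expect n f" "expect n f \<le> 1 / 2"
    and \<beta>: "0 < \<beta>" and W1: "\<beta> * (expect n f)\<^sup>2 * ln (1 / expect n f) \<le> W1 n f"
  shows "\<exists>g. halfspace n g \<and> \<beta> / 160 * expect n f \<le> cov n f g"
proof (rule ccontr)
  assume contra: "\<not> ?thesis"
  define \<mu> L where "\<mu> = expect n f" and "L = ln (1 / \<mu>)"
  have L: "2 / 3 \<le> L" unfolding L_def using mu by (intro ln_inverse_measure_ge) (auto simp: \<mu>_def)
  have \<mu>: "0 < \<mu>" using mu by (simp add: \<mu>_def)
  define s \<sigma> where "s = sqrt \<beta>" and "\<sigma> = sqrt L"
  have s: "0 < s" "\<beta> = s\<^sup>2" using \<beta> by (auto simp: s_def)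
  have \<sigma>: "0 < \<sigma>" "L = \<sigma>\<^sup>2" using L by (auto simp: \<sigma>_def)
  define w where "w = sqrt (W1 n f)"
  have w_ge: "s * \<sigma> * \<mu> \<le> w"
    unfolding w_def using W1 s \<sigma> \<mu>
    by (intro real_le_rsqrt) (simp add: L_def[symmetric] \<mu>_def[symmetric] power_mult_distrib mult_ac)
  have w: "0 < w" using w_ge s \<sigma> \<mu> by (smt (verit) mult_pos_pos)
  have w2: "w\<^sup>2 = W1 n f" using w by (simp add: w_def)
  define b where "b i = fourier1 n f i / w" for i
  have b: "(\<Sum>i<n. (b i)\<^sup>2) = 1"
    using w by (simp add: b_def power_divide sum_divide_distrib[symmetric] W1_def[symmetric] w2[symmetric])
  have "expect n (\<lambda>x. f x * (\<Sum>i<n. b i * x i)) = (\<Sum>i<n. b i * fourier1 n f i)"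
    by (simp add: sum_distrib_left expect_sum fourier1_def expect_cmult[symmetric] mult_ac)
  also have "\<dots> = W1 n f / w"
    by (simp add: b_def W1_def power2_eq_square sum_divide_distrib)
  also have "\<dots> = w"
    using w by (simp add: w2[symmetric] power2_eq_square)
  finally have corr: "expect n (\<lambda>x. f x * (\<Sum>i<n. b i * x i)) = w" .
  \<comment> \<open>With this \<open>T\<close> the truncation error is at most \<open>39 / 80\<close>, just below half, of \<open>s \<sigma> \<mu>\<close>, and
    covariances bounded by \<open>\<beta> \<mu> / 160\<close> contribute at most the other half.\<close>
  define T where "T = 40 * \<sigma> / s"
  have T: "0 < T" using s \<sigma> by (simp add: T_def)
  have "w \<le> 2 * T * (\<beta> / 160 * \<mu>) + (expect n (\<lambda>x. f x * (\<Sum>i<n. b i * x i)\<^sup>2) + expect n f) / T"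
    unfolding corr[symmetric]
  proof (rule linear_correlation_le[OF f b T])
    fix t
    have "halfspace n (\<lambda>x. of_bool (t < (\<Sum>i<n. b i * x i)))"
      unfolding halfspace_def by auto
    then show "cov n f (\<lambda>x. of_bool (t < (\<Sum>i<n. b i * x i))) \<le> \<beta> / 160 * \<mu>"
      using contra by (auto simp: \<mu>_def not_le intro: less_imp_le)
  qed
  also have "\<dots> \<le> 2 * T * (\<beta> / 160 * \<mu>) + (18 * L * \<mu> + 3 / 2 * L * \<mu>) / T"
  proof (intro add_left_mono divide_right_mono add_mono)
    show "expect n (\<lambda>x. f x * (\<Sum>i<n. b i * x i)\<^sup>2) \<le> 18 * L * \<mu>"
      using linear_form_second_moment_on_small_set[OF f mu b] by (simp add: L_def \<mu>_def)
    have "1 * \<mu> \<le> 3 / 2 * L * \<mu>" using L \<mu> by (intro mult_right_mono) auto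
    then show "expect n f \<le> 3 / 2 * L * \<mu>" by (simp add: \<mu>_def)
  qed (use T in auto)
  also have "\<dots> = s * \<sigma> * \<mu> * (1 / 2 + 39 / 80)"
    using s \<sigma> by (simp add: T_def power2_eq_square field_simps)
  also have "\<dots> < s * \<sigma> * \<mu> * 1"
    using s \<sigma> \<mu> by (intro mult_strict_left_mono) auto
  finally show False using w_ge by simp
qed

theorem proposition1p9:
  shows "\<exists>c::real. 0 < c \<and> c \<le> ln 2 \<and>
    (\<forall>\<alpha>::real. 0 < \<alpha> \<longrightarrow>
      (\<exists>\<beta> \<gamma>::real. 0 < \<beta> \<and> 0 < \<gamma> \<and>
        (\<forall>(n::nat) (f :: (nat \<Rightarrow> real) \<Rightarrow> real).
          1 \<le> n \<longrightarrow> f \<in> cube n \<rightarrow> {0, 1} \<longrightarrow> cube_monotone n f \<longrightarrow> expect n f \<le> 1 / 2 \<longrightarrow>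
          noise_stability n (c / ln (1 / expect n f)) f \<ge> \<alpha> * (expect n f)\<^sup>2 \<longrightarrow>
          W1 n f \<ge> \<beta> * (expect n f)\<^sup>2 * ln (1 / expect n f) \<and>
          (\<exists>g. halfspace n g \<and> cov n f g \<ge> \<gamma> * expect n f))))"
proof (rule exI[of _ "1 / 15"], intro conjI allI impI)
  show "1 / 15 \<le> ln (2::real)" using ln2_ge_two_thirds by linarith
  fix \<alpha> :: real assume \<alpha>: "0 < \<alpha>"
  define \<beta> where "\<beta> = 135 * \<alpha> ^ 3 / (exp 2)\<^sup>2"
  have \<beta>: "0 < \<beta>" using \<alpha> by (simp add: \<beta>_def)
  show "\<exists>\<beta> \<gamma>::real. 0 < \<beta> \<and> 0 < \<gamma> \<and>
        (\<forall>(n::nat) (f :: (nat \<Rightarrow> real) \<Rightarrow> real).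
          1 \<le> n \<longrightarrow> f \<in> cube n \<rightarrow> {0, 1} \<longrightarrow> cube_monotone n f \<longrightarrow> expect n f \<le> 1 / 2 \<longrightarrow>
          noise_stability n (1 / 15 / ln (1 / expect n f)) f \<ge> \<alpha> * (expect n f)\<^sup>2 \<longrightarrow>
          W1 n f \<ge> \<beta> * (expect n f)\<^sup>2 * ln (1 / expect n f) \<and>
          (\<exists>g. halfspace n g \<and> cov n f g \<ge> \<gamma> * expect n f))"
  proof (rule exI[of _ \<beta>], rule exI[of _ "\<beta> / 160"], intro conjI[OF \<beta>] conjI[of "0 < \<beta> / 160"] allI impI)
    show "0 < \<beta> / 160" using \<beta> by simp
    fix n :: nat and f :: "(nat \<Rightarrow> real) \<Rightarrow> real"
    assume f: "f \<in> cube n \<rightarrow> {0, 1}" and mono: "cube_monotone n f" and half: "expect n f \<le> 1 / 2"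
      and stable: "noise_stability n (1 / 15 / ln (1 / expect n f)) f \<ge> \<alpha> * (expect n f)\<^sup>2"
    show "W1 n f \<ge> \<beta> * (expect n f)\<^sup>2 * ln (1 / expect n f) \<and>
        (\<exists>g. halfspace n g \<and> cov n f g \<ge> \<beta> / 160 * expect n f)"
    proof (cases "expect n f = 0")
      case True
      \<comment> \<open>All bounds are zero, so the empty halfspace will do.\<close>
      have "halfspace n (\<lambda>x. of_bool (0 < (\<Sum>i<n. 0 * x i)))"
        unfolding halfspace_def by (intro exI[of _ "\<lambda>_. 0"] exI[of _ 0]) auto
      moreover have "cov n f (\<lambda>x. of_bool (0 < (\<Sum>i<n. 0 * x i))) = 0"
        by (simp add: cov_eq)
      moreover have "0 \<le> W1 n f" unfolding W1_def by (intro sum_nonneg) auto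
      ultimately show ?thesis using True by auto
    next
      case False
      moreover have "0 \<le> expect n f"
        using indicator_cases[OF f] by (intro expect_nonneg) force
      ultimately have mu: "0 < expect n f" by simp
      have W1: "\<beta> * (expect n f)\<^sup>2 * ln (1 / expect n f) \<le> W1 n f"
        unfolding \<beta>_def by (rule first_level_weight_lower_bound[OF f mono mu half \<alpha> stable])
      then show ?thesis
        using correlated_halfspace_exists[OF f mu half \<beta>] by auto
    qed
  qed
qed simp

end
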